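(* Suppose Assumption 1 holds with $\alpha\in(0,1]$, and let $(f_t)_{t\in\mathbb N}$ be the online gradient descent iterates with step sizes satisfying $\eta_t\le\frac{1}{A\kappa^2}$ and $\eta_{t+1}\le\eta_t$ for all $t\in\mathbb N$, and $\sum_{t=1}^\infty\eta_t^2<\infty$. Then there is a constant $\widetilde C'$ independent of $T$ and $\delta$ such that for every integer $T\ge2$ and every $\delta\in(0,1)$, with probability at least $1-\delta$, $$\mathcal E(f_{T+1})-\mathcal E(f_H)\le\widetilde C'\max\Big\{\Big[\sum_{t=\lfloor T/2\rfloor}^{T}\eta_t\Big]^{-1},\ \eta_{\lfloor T/2\rfloor}^{\alpha},\ \sum_{t=\lfloor T/2\rfloor}^{T}\eta_t^{1+\alpha}\Big\}\log^2\frac{3T}{\delta},$$ where $\lfloor T/2\rfloor$ is the largest integer not exceeding $T/2$.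
   Context: Setting: Let $\mathcal X\subset\mathbb R^d$, $\mathcal Y\subset\mathbb R$, $\mathcal Z=\mathcal X\times\mathcal Y$, and let $\rho$ be a Borel probability measure on $\mathcal Z$. Let $K:\mathcal X\times\mathcal X\to\mathbb R$ be a continuous, symmetric, positive semi-definite kernel with reproducing kernel Hilbert space $H_K$ (inner product $\langle\cdot,\cdot\rangle$, norm $\|\cdot\|$), $K_x:=K(x,\cdot)$, reproducing property $f(x)=\langle f,K_x\rangle$, and $\kappa:=\sup_{x\in\mathcal X}\sqrt{K(x,x)}<\infty$. Let $\phi:\mathcal Y\times\mathbb R\to[0,\infty)$ be a loss function, differentiable in its second argument, and write $\phi'(y,s)$ for its derivative with respect to $s$. The generalization error of $f:\mathcal X\to\mathbb R$ is $\mathcal E(f)=\int_{\mathcal Z}\phi(y,f(x))\,d\rho(x,y)$. It is assumed that a minimizer $f_H\in\arg\min_{f\in H_K}\mathcal E(f)$ exists and that $\max\{\sup_{y\in\mathcal Y}\phi(y,0),\ \sup_{(x,y)\in\mathcal Z}\phi(y,f_H(x))\}<\infty$. Let $z_t=(x_t,y_t)$, $t\in\mathbb N$, be i.i.d. samples from $\rho$, let $(\eta_t)_{t\in\mathbb N}$ be positive step sizes, and define the online gradient descent iterates by $f_1=0$ and $f_{t+1}=f_t-\eta_t\phi'(y_t,f_t(x_t))K_{x_t}$ for $t\in\mathbb N$ (so $f_t$ depends only on $z_1,\dots,z_{t-1}$). Assumption 1: for every $y\in\mathcal Y$, $\phi(y,\cdot)$ is convex and differentiable, and there are constants $\alpha\in(0,1]$,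 $L>0$ with $|\phi'(y,s)-\phi'(y,\tilde s)|\le L|s-\tilde s|^{\alpha}$ for all $s,\tilde s\in\mathbb R$, $y\in\mathcal Y$. Constants: $A=2\alpha^{\frac{1-\alpha}{1+\alpha}}L^{\frac{2}{1+\alpha}}(1+\alpha)$ and $B=\alpha^{-\frac{2\alpha}{1+\alpha}}L^{\frac{2}{1+\alpha}}(1-\alpha^2)$. *)

theory Defs
  imports "HOL-Probability.Probability"
begin

text \<open>RKHS: a real Hilbert space 'h whose elements are identified with functions on X
 via an evaluation map evl (injective on X), with kernel sections Kx x and the reproducing property.\<close>
definition is_RKHS ::
  "('x \<Rightarrow> 'x \<Rightarrow> real) \<Rightarrow> 'x set \<Rightarrow> ('h::{real_inner,complete_space} \<Rightarrow> 'x \<Rightarrow> real) \<Rightarrow> ('x \<Rightarrow> 'h) \<Rightarrow> bool" where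
  "is_RKHS K X evl Kx \<longleftrightarrow>
     (\<forall>f g. (\<forall>x\<in>X. evl f x = evl g x) \<longrightarrow> f = g) \<and>
     (\<forall>x\<in>X. \<forall>y\<in>X. evl (Kx x) y = K x y) \<and>
     (\<forall>f. \<forall>x\<in>X. evl f x = inner f (Kx x))"

definition mercer_kernel :: "('a::topological_space \<Rightarrow> 'a \<Rightarrow> real) \<Rightarrow> 'a set \<Rightarrow> bool" where
  "mercer_kernel K X \<longleftrightarrow>
     continuous_on (X \<times> X) (\<lambda>(x, y). K x y) \<and>
     (\<forall>x\<in>X. \<forall>y\<in>X. K x y = K y x) \<and>
     (\<forall>n (c::nat \<Rightarrow> real) xs. (\<forall>i<n. xs i \<in> X) \<longrightarrow>
        0 \<le> (\<Sum>i<n. \<Sum>j<n. c i * c j * K (xs i) (xs j)))"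

definition kappa :: "('x \<Rightarrow> 'x \<Rightarrow> real) \<Rightarrow> 'x set \<Rightarrow> real" where
  "kappa K X = (SUP x\<in>X. sqrt (K x x))"

text \<open>Generalization error (nonnegative loss, so a nonnegative integral in ennreal).\<close>
definition gen_err :: "('x \<times> real) measure \<Rightarrow> (real \<Rightarrow> real \<Rightarrow> real) \<Rightarrow> ('x \<Rightarrow> real) \<Rightarrow> ennreal" where
  "gen_err \<rho> \<phi> f = (\<integral>\<^sup>+ z. ennreal (\<phi> (snd z) (f (fst z))) \<partial>\<rho>)"

text \<open>Online gradient descent: ogd ... n = f_(n+1); so ogd ... 0 = f_1 = 0 and
  f_(t+1) = f_t - eta t * phi'(y_t, f_t(x_t)) K_(x_t).\<close>
primrec ogd :: "(real \<Rightarrow> real \<Rightarrow> real) \<Rightarrow> ('h::real_vector \<Rightarrow> 'x \<Rightarrow> real) \<Rightarrow> ('x \<Rightarrow> 'h)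
   \<Rightarrow> (nat \<Rightarrow> real) \<Rightarrow> (nat \<Rightarrow> 'x \<times> real) \<Rightarrow> nat \<Rightarrow> 'h" where
  "ogd \<phi>' evl Kx \<eta> zs 0 = 0"
| "ogd \<phi>' evl Kx \<eta> zs (Suc n) =
     ogd \<phi>' evl Kx \<eta> zs n -
       (\<eta> (Suc n) * \<phi>' (snd (zs (Suc n))) (evl (ogd \<phi>' evl Kx \<eta> zs n) (fst (zs (Suc n)))))
         *\<^sub>R Kx (fst (zs (Suc n)))"

definition constA :: "real \<Rightarrow> real \<Rightarrow> real" where
  "constA \<alpha> L = 2 * \<alpha> powr ((1 - \<alpha>) / (1 + \<alpha>)) * L powr (2 / (1 + \<alpha>)) * (1 + \<alpha>)"

end

(* Write d_t for the excess loss of f_t at z_t, e_t for its conditional mean (the excess risk), and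
   l = log(3T/delta).  Convexity and the self-bounding property phi'^2 <= A phi + const of Hoelder
   smooth losses give |f_{t+1} - f_H|^2 <= |f_t - f_H|^2 - c_t d_t + O(eta_t^2) with
   eta_t <= c_t <= 2 eta_t.  Summing, the martingale terms c_t (e_t - d_t) with eta_t <= eps / l are
   absorbed by a Bernstein-type exponential supermartingale stopped when the norm leaves a ball of
   squared radius R = O(l): the conditional variance is O(c_t^2 R (e_t + 1)), so with parameter
   lambda = 2 l / R the part proportional to e_t is half of the decrease and the rest costs R / 2 + O(l).
   The finitely many larger steps cost O(l) because eta_t <= eta_t^2 l / eps.  Hence, with high
   probability, |f_t - f_H|^2 <= R for all t <= T and the sum of eta_t e_t is O(l^2).

   The risk has a Hoelder continuous gradient, so
   e_{t+1} <= e_t - eta_t <grad, g_t> + O(R eta_t^{1+alpha}), where g_t is the stochastic gradient with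
   conditional mean grad.  The noise has conditional variance O(R eta_t^2 |grad|^2), which a second
   exponential supermartingale absorbs into -eta_t |grad|^2 up to O(R l eta_{T/2}).  Averaging the
   resulting bounds e_{T+1} <= e_s + ... over T/2 <= s <= T with weights eta_s gives the rate. *)
theory Submission
  imports Defs
begin

text \<open>The difficulty is a circle: losses, and with them the martingale differences, are
  bounded only while the iterates are bounded, and boundedness of the iterates is what the
  martingale estimate should give. The circle is broken by switching an increment off whenever the
  current iterate lies outside the ball. The moment bounds then hold for every history, and a
  pathwise induction shows that on the good event no iterate up to time T leaves the ball.

  One logarithm of the rate is the squared radius. The other enters through the large steps, whose
  total weight is of order l, and through the tail level l of the second supermartingale.

  Histories are points of a finite product space, and a conditional expectation is an integral over
  the newest coordinate, so Fubini takes the place of filtrations. The Hilbert space is not assumed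
  separable, so only real quantities are shown to be measurable, through scalar recursions and
  parameter integrals; the gradient of the risk appears as a Riesz representer.\<close>

section \<open>Exponential moments and supermartingales on finite product spaces\<close>

lemma exp_le_quadratic:
  fixes x :: real
  assumes "\<bar>x\<bar> \<le> 1"
  shows "exp x \<le> 1 + x + x\<^sup>2"
proof (cases "0 \<le> x")
  case True
  then show ?thesis using assms by (intro exp_bound) auto
next
  case False
  \<comment> \<open>For x < 0 the product is 1 - x^3, hence at least 1, and 1 - x \<le> exp (-x)
    turns this into the claim.\<close>
  have "1 \<le> (1 + x + x\<^sup>2) * (1 - x)"
  proof -
    have "(1 + x + x\<^sup>2) * (1 - x) = 1 - x ^ 3"
      by (simp add: algebra_simps power2_eq_square power3_eq_cube)
    moreover have "x ^ 3 \<le> 0"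
      using False by (simp add: power_le_zero_eq)
    ultimately show ?thesis by linarith
  qed
  also have "\<dots> \<le> (1 + x + x\<^sup>2) * exp (- x)"
  proof (rule mult_left_mono)
    show "1 - x \<le> exp (- x)" using exp_ge_add_one_self[of "- x"] by simp
    show "0 \<le> 1 + x + x\<^sup>2" using assms zero_le_power2[of x] by linarith
  qed
  finally show ?thesis
    by (simp add: exp_minus field_simps)
qed

lemma (in prob_space) bounded_expectation:
  fixes \<xi> :: "'a \<Rightarrow> real"
  assumes [measurable]: "\<xi> \<in> borel_measurable M"
    and b: "\<And>\<omega>. \<omega> \<in> space M \<Longrightarrow> \<bar>\<xi> \<omega>\<bar> \<le> b"
  shows "integrable M \<xi>" "\<bar>expectation \<xi>\<bar> \<le> b"
proof -
  show int: "integrable M \<xi>"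
    using b by (intro integrable_const_bound[where B = b]) auto
  have "\<bar>expectation \<xi>\<bar> \<le> expectation (\<lambda>\<omega>. \<bar>\<xi> \<omega>\<bar>)" by (rule integral_abs_bound)
  also have "\<dots> \<le> expectation (\<lambda>_. b)"
    using b int by (intro integral_mono) auto
  finally show "\<bar>expectation \<xi>\<bar> \<le> b" by (simp add: prob_space)
qed

text \<open>With u = a (E \<xi> - \<xi>), the condition on a and b forces |u| \<le> 1, so exp u
  \<le> 1 + u + u^2. The linear term has mean zero, and 1 + v \<le> exp v absorbs the quadratic one.
  The compensator v is compared with the second moment instead of the variance because second
  moments are what the later estimates control.\<close>

lemma (in prob_space) exp_moment_le_1:
  fixes \<xi> :: "'a \<Rightarrow> real"
  assumes [measurable]: "\<xi> \<in> borel_measurable M"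
    and b: "\<And>\<omega>. \<omega> \<in> space M \<Longrightarrow> \<bar>\<xi> \<omega>\<bar> \<le> b" and a: "\<bar>a\<bar> * b \<le> 1 / 2"
    and v: "a\<^sup>2 * expectation (\<lambda>\<omega>. (\<xi> \<omega>)\<^sup>2) \<le> v"
  shows "(\<integral>\<^sup>+\<omega>. ennreal (exp (a * (expectation \<xi> - \<xi> \<omega>) - v)) \<partial>M) \<le> 1"
proof -
  define \<mu> where "\<mu> = expectation \<xi>"
  have "\<bar>(\<xi> \<omega>)\<^sup>2\<bar> \<le> b\<^sup>2" if "\<omega> \<in> space M" for \<omega>
    using power_mono[OF b[OF that], of 2] by simp
  then have int: "integrable M \<xi>" "integrable M (\<lambda>\<omega>. (\<xi> \<omega>)\<^sup>2)"
    using b by (auto intro!: bounded_expectation(1))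
  have \<mu>b: "\<bar>\<mu>\<bar> \<le> b"
    unfolding \<mu>_def using b by (rule bounded_expectation(2)[rotated]) measurable
  define u where "u \<omega> = a * (\<mu> - \<xi> \<omega>)" for \<omega>
  have u1: "\<bar>u \<omega>\<bar> \<le> 1" if "\<omega> \<in> space M" for \<omega>
  proof -
    have "\<bar>u \<omega>\<bar> \<le> \<bar>a\<bar> * (b + b)"
      unfolding u_def abs_mult using b[OF that] \<mu>b by (intro mult_left_mono) auto
    also have "\<dots> \<le> 1" using a by (simp add: algebra_simps)
    finally show ?thesis .
  qed
  have u_eq: "1 + u \<omega> + (u \<omega>)\<^sup>2 = (1 + a * \<mu> + a\<^sup>2 * \<mu>\<^sup>2) - (a + 2 * a\<^sup>2 * \<mu>) * \<xi> \<omega> + a\<^sup>2 * (\<xi> \<omega>)\<^sup>2" for \<omega>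
    by (simp add: u_def power2_eq_square algebra_simps)
  have intu: "integrable M (\<lambda>\<omega>. exp (- v) * (1 + u \<omega> + (u \<omega>)\<^sup>2))"
    unfolding u_eq using int by auto
  have "expectation (\<lambda>\<omega>. 1 + u \<omega> + (u \<omega>)\<^sup>2) = 1 - a\<^sup>2 * \<mu>\<^sup>2 + a\<^sup>2 * expectation (\<lambda>\<omega>. (\<xi> \<omega>)\<^sup>2)"
    unfolding u_eq using int
    by (simp add: prob_space \<mu>_def[symmetric]) (simp add: algebra_simps power2_eq_square)
  also have "\<dots> \<le> 1 + v" using v mult_nonneg_nonneg[OF zero_le_power2[of a] zero_le_power2[of \<mu>]] by linarith
  also have "\<dots> \<le> exp v" by (rule exp_ge_add_one_self)
  finally have E: "expectation (\<lambda>\<omega>. 1 + u \<omega> + (u \<omega>)\<^sup>2) \<le> exp v" .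
  have "(\<integral>\<^sup>+\<omega>. ennreal (exp (u \<omega> - v)) \<partial>M) \<le> (\<integral>\<^sup>+\<omega>. ennreal (exp (- v) * (1 + u \<omega> + (u \<omega>)\<^sup>2)) \<partial>M)"
    using exp_le_quadratic[OF u1]
    by (intro nn_integral_mono) (auto simp: exp_diff exp_minus field_simps intro!: ennreal_leI)
  also have "\<dots> = ennreal (expectation (\<lambda>\<omega>. exp (- v) * (1 + u \<omega> + (u \<omega>)\<^sup>2)))"
    using intu exp_le_quadratic[OF u1]
    by (intro nn_integral_eq_integral AE_I2 mult_nonneg_nonneg)
      (auto intro: order_trans[OF exp_ge_zero])
  also have "\<dots> \<le> ennreal 1"
  proof (rule ennreal_leI)
    have "exp (- v) * expectation (\<lambda>\<omega>. 1 + u \<omega> + (u \<omega>)\<^sup>2) \<le> exp (- v) * exp v"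
      using E by (intro mult_left_mono) auto
    then show "expectation (\<lambda>\<omega>. exp (- v) * (1 + u \<omega> + (u \<omega>)\<^sup>2)) \<le> 1"
      by (simp flip: exp_add)
  qed
  finally show ?thesis by (simp add: u_def \<mu>_def)
qed

text \<open>The newest coordinate is integrated first, with the earlier increments frozen by
  \<open>adapted\<close>; \<open>step\<close>, the supermartingale property stated for every past h,
  bounds the inner integral by 1. Each \<open>D t\<close> is required to be measurable on the longer
  products too, since the sums of increments live there.\<close>

lemma (in prob_space) exp_supermartingale:
  fixes D :: "nat \<Rightarrow> (nat \<Rightarrow> 'a) \<Rightarrow> real"
  assumes meas: "\<And>t n. 1 \<le> t \<Longrightarrow> t \<le> n \<Longrightarrow> n \<le> T \<Longrightarrow> D t \<in> borel_measurable (Pi\<^sub>M {1..n} (\<lambda>_. M))"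
    and adapted: "\<And>t h i x. 1 \<le> t \<Longrightarrow> t < i \<Longrightarrow> D t (h(i := x)) = D t h"
    and step: "\<And>t h. 1 \<le> t \<Longrightarrow> t \<le> T \<Longrightarrow> h \<in> space (Pi\<^sub>M {1..t - 1} (\<lambda>_. M)) \<Longrightarrow>
      (\<integral>\<^sup>+x. ennreal (exp (D t (h(t := x)))) \<partial>M) \<le> 1"
    and "n \<le> T" and "1 \<le> s"
  shows "(\<integral>\<^sup>+h. ennreal (exp (\<Sum>t = s..n. D t h)) \<partial>Pi\<^sub>M {1..n} (\<lambda>_. M)) \<le> 1"
  using \<open>n \<le> T\<close>
proof (induction n)
  case 0
  interpret P: prob_space "Pi\<^sub>M {1..0::nat} (\<lambda>_. M)"
    by (intro prob_space_PiM) unfold_locales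
  show ?case using \<open>1 \<le> s\<close> P.emeasure_space_1 by simp
next
  case (Suc n)
  interpret product_sigma_finite "\<lambda>_::nat. M" ..
  have ins: "{1..Suc n} = insert (Suc n) {1..n}" by auto
  define S where "S h = (\<Sum>t = s..n. D t h)" for h
  have [measurable]: "S \<in> borel_measurable (Pi\<^sub>M {1..n} (\<lambda>_. M))"
    unfolding S_def using Suc.prems \<open>1 \<le> s\<close> by (intro borel_measurable_sum meas) auto
  have [measurable]: "(\<lambda>h. \<Sum>t = s..Suc n. D t h) \<in> borel_measurable (Pi\<^sub>M {1..Suc n} (\<lambda>_. M))"
    using Suc.prems \<open>1 \<le> s\<close> by (intro borel_measurable_sum meas) auto
  have "(\<integral>\<^sup>+h. ennreal (exp (\<Sum>t = s..Suc n. D t h)) \<partial>Pi\<^sub>M {1..Suc n} (\<lambda>_. M)) =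
      (\<integral>\<^sup>+h. (\<integral>\<^sup>+x. ennreal (exp (\<Sum>t = s..Suc n. D t (h(Suc n := x)))) \<partial>M) \<partial>Pi\<^sub>M {1..n} (\<lambda>_. M))"
    unfolding ins
  proof (rule product_nn_integral_insert)
    show "(\<lambda>h. ennreal (exp (\<Sum>t = s..Suc n. D t h))) \<in> borel_measurable (Pi\<^sub>M (insert (Suc n) {1..n}) (\<lambda>_. M))"
      unfolding ins[symmetric] by measurable
  qed auto
  also have "\<dots> \<le> (\<integral>\<^sup>+h. ennreal (exp (S h)) \<partial>Pi\<^sub>M {1..n} (\<lambda>_. M))"
  proof (rule nn_integral_mono)
    fix h assume h: "h \<in> space (Pi\<^sub>M {1..n} (\<lambda>_. M))"
    have D: "D t (h(Suc n := x)) = D t h" if "t \<in> {s..n}" for t x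
      using that \<open>1 \<le> s\<close> by (intro adapted) auto
    show "(\<integral>\<^sup>+x. ennreal (exp (\<Sum>t = s..Suc n. D t (h(Suc n := x)))) \<partial>M) \<le> ennreal (exp (S h))"
    proof (cases "s \<le> Suc n")
      case True
      have m: "D (Suc n) \<in> borel_measurable (Pi\<^sub>M (insert (Suc n) {1..n}) (\<lambda>_. M))"
        using Suc.prems meas[of "Suc n" "Suc n"] unfolding ins by simp
      have [measurable]: "(\<lambda>x. D (Suc n) (h(Suc n := x))) \<in> borel_measurable M"
        by (rule measurable_compose[OF measurable_component_update[OF h] m]) auto
      have "(\<integral>\<^sup>+x. ennreal (exp (\<Sum>t = s..Suc n. D t (h(Suc n := x)))) \<partial>M)
          = (\<integral>\<^sup>+x. ennreal (exp (S h)) * ennreal (exp (D (Suc n) (h(Suc n := x)))) \<partial>M)"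
        using True D by (intro nn_integral_cong) (simp add: S_def exp_add ennreal_mult)
      also have "\<dots> = ennreal (exp (S h)) * (\<integral>\<^sup>+x. ennreal (exp (D (Suc n) (h(Suc n := x)))) \<partial>M)"
        by (rule nn_integral_cmult) measurable
      also have "\<dots> \<le> ennreal (exp (S h)) * 1"
        using Suc.prems h by (intro mult_left_mono step) auto
      finally show ?thesis by simp
    next
      case False
      then show ?thesis by (simp add: S_def emeasure_space_1)
    qed
  qed
  also have "\<dots> \<le> 1" unfolding S_def using Suc by auto
  finally show ?case .
qed

text \<open>Chernoff bound with parameter 1. Replacing \<open>D t\<close> by 0 beyond n extends the
  partial sum to T, so that the events for all n lie in the one space of T samples and a union bound
  applies to them.\<close>

lemma (in prob_space) prob_supermartingale_gt:
  fixes D :: "nat \<Rightarrow> (nat \<Rightarrow> 'a) \<Rightarrow> real"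
  assumes meas: "\<And>t n. 1 \<le> t \<Longrightarrow> t \<le> n \<Longrightarrow> n \<le> T \<Longrightarrow> D t \<in> borel_measurable (Pi\<^sub>M {1..n} (\<lambda>_. M))"
    and adapted: "\<And>t h i x. 1 \<le> t \<Longrightarrow> t < i \<Longrightarrow> D t (h(i := x)) = D t h"
    and step: "\<And>t h. 1 \<le> t \<Longrightarrow> t \<le> T \<Longrightarrow> h \<in> space (Pi\<^sub>M {1..t - 1} (\<lambda>_. M)) \<Longrightarrow>
      (\<integral>\<^sup>+x. ennreal (exp (D t (h(t := x)))) \<partial>M) \<le> 1"
    and "1 \<le> s" "n \<le> T"
  shows "measure (Pi\<^sub>M {1..T} (\<lambda>_. M)) {h \<in> space (Pi\<^sub>M {1..T} (\<lambda>_. M)). l < (\<Sum>t = s..n. D t h)} \<le> exp (- l)"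
proof -
  define D' where "D' t h = (if t \<le> n then D t h else 0)" for t h
  let ?P = "Pi\<^sub>M {1..T} (\<lambda>_. M)"
  interpret P: prob_space ?P by (intro prob_space_PiM) unfold_locales
  have sum_eq: "(\<Sum>t = s..T. D' t h) = (\<Sum>t = s..n. D t h)" for h
    using \<open>n \<le> T\<close> by (intro sum.mono_neutral_cong_right) (auto simp: D'_def)
  have le1: "(\<integral>\<^sup>+h. ennreal (exp (\<Sum>t = s..T. D' t h)) \<partial>?P) \<le> 1"
  proof (rule exp_supermartingale[where T = T])
    show "D' t \<in> borel_measurable (Pi\<^sub>M {1..k} (\<lambda>_. M))" if "1 \<le> t" "t \<le> k" "k \<le> T" for t k
      using meas[OF that] by (cases "t \<le> n") (simp_all add: D'_def[abs_def])
    show "D' t (h(i := x)) = D' t h" if "1 \<le> t" "t < i" for t h i x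
      using adapted[OF that] by (simp add: D'_def)
    show "(\<integral>\<^sup>+x. ennreal (exp (D' t (h(t := x)))) \<partial>M) \<le> 1"
      if "1 \<le> t" "t \<le> T" "h \<in> space (Pi\<^sub>M {1..t - 1} (\<lambda>_. M))" for t h
      using step[OF that] by (cases "t \<le> n") (simp_all add: D'_def emeasure_space_1)
  qed (use \<open>1 \<le> s\<close> in auto)
  have m[measurable]: "(\<lambda>h. \<Sum>t = s..n. D t h) \<in> borel_measurable ?P"
    using \<open>1 \<le> s\<close> \<open>n \<le> T\<close> by (intro borel_measurable_sum meas) auto
  have "emeasure ?P {h \<in> space ?P. l < (\<Sum>t = s..n. D t h)} \<le>
      emeasure ?P {h \<in> space ?P. l \<le> (\<Sum>t = s..n. D t h)}"
    by (rule emeasure_mono, blast intro: less_imp_le, measurable)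
  also have "\<dots> \<le> ennreal (exp (- 1 * l)) * (\<integral>\<^sup>+h. ennreal (exp (1 * (\<Sum>t = s..n. D t h))) * indicator (space ?P) h \<partial>?P)"
    by (intro Chernoff_ineq_nn_integral_ge borel_measurable_times borel_measurable_indicator m) auto
  also have "(\<integral>\<^sup>+h. ennreal (exp (1 * (\<Sum>t = s..n. D t h))) * indicator (space ?P) h \<partial>?P) =
      (\<integral>\<^sup>+h. ennreal (exp (\<Sum>t = s..T. D' t h)) \<partial>?P)"
    unfolding sum_eq by (intro nn_integral_cong) auto
  also have "ennreal (exp (- 1 * l)) * \<dots> \<le> ennreal (exp (- 1 * l)) * 1"
    using le1 by (intro mult_left_mono) auto
  finally show ?thesis unfolding P.emeasure_eq_measure by simp
qed

text \<open>The representing vector minimises \<open>\<parallel>h\<parallel>\<^sup>2 - 2 l h\<close>; minimising sequences are Cauchy by the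
  parallelogram identity.\<close>
lemma riesz_representation:
  fixes l :: "'h::{real_inner,complete_space} \<Rightarrow> real"
  assumes "bounded_linear l"
  obtains v where "\<And>h. l h = inner v h"
proof -
  interpret bounded_linear l by fact
  define J where "J h = (norm h)\<^sup>2 - 2 * l h" for h
  obtain c where c: "\<And>h. \<bar>l h\<bar> \<le> norm h * c"
    using bounded by auto
  have J_ge: "- c\<^sup>2 \<le> J h" for h
  proof -
    have "0 \<le> (norm h - c)\<^sup>2" by simp
    then show ?thesis using c[of h] by (simp add: J_def power2_eq_square algebra_simps)
  qed
  define m where "m = Inf (range J)"
  have m_le: "m \<le> J h" for h
    unfolding m_def using J_ge by (intro cInf_lower bdd_belowI[where m = "- c\<^sup>2"]) auto
  have "\<exists>h. J h < m + inverse (real (Suc n))" for n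
    using cInf_lessD[of "range J" "m + inverse (real (Suc n))"] by (auto simp: m_def)
  then obtain u where u: "\<And>n. J (u n) < m + inverse (real (Suc n))" by metis
  have para: "(norm (h - k))\<^sup>2 \<le> 2 * (J h - m) + 2 * (J k - m)" for h k
  proof -
    have "(norm (h - k))\<^sup>2 = 2 * J h + 2 * J k - 4 * J ((1 / 2) *\<^sub>R (h + k))"
      unfolding J_def power2_norm_eq_inner scaleR add
      by (simp add: inner_diff inner_add inner_commute algebra_simps)
    then show ?thesis using m_le[of "(1 / 2) *\<^sub>R (h + k)"] by simp
  qed
  have "Cauchy u"
  proof (rule metric_CauchyI)
    fix e :: real assume "0 < e"
    then obtain N where N: "inverse (real (Suc N)) < e\<^sup>2 / 4"
      using reals_Archimedean[of "e\<^sup>2 / 4"] by auto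
    have "dist (u i) (u j) < e" if "i \<ge> N" "j \<ge> N" for i j
    proof -
      have "inverse (real (Suc k)) \<le> inverse (real (Suc N))" if "k \<ge> N" for k
        using that by (intro le_imp_inverse_le) auto
      then have *: "J (u k) - m < e\<^sup>2 / 4" if "k \<ge> N" for k
        using u[of k] N that by (smt (verit))
      have "(norm (u i - u j))\<^sup>2 < e\<^sup>2"
        using para[of "u i" "u j"] *[OF \<open>i \<ge> N\<close>] *[OF \<open>j \<ge> N\<close>]
        by (auto simp: field_simps)
      then show ?thesis using \<open>0 < e\<close> by (simp add: dist_norm power_less_imp_less_base)
    qed
    then show "\<exists>M. \<forall>i\<ge>M. \<forall>j\<ge>M. dist (u i) (u j) < e" by blast
  qed
  then obtain v where v: "u \<longlonglongrightarrow> v" using Cauchy_convergent convergentD by blast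
  have "(\<lambda>n. J (u n)) \<longlonglongrightarrow> J v"
    unfolding J_def by (intro tendsto_intros tendsto v)
  moreover have "(\<lambda>n. m + inverse (real (Suc n))) \<longlonglongrightarrow> m + 0"
    by (intro tendsto_intros LIMSEQ_inverse_real_of_nat)
  ultimately have "J v \<le> m"
    using u by (intro LIMSEQ_le[of "\<lambda>n. J (u n)" "J v" "\<lambda>n. m + inverse (real (Suc n))"]) (auto intro: less_imp_le)
  have "l h = inner v h" for h
  proof (rule ccontr)
    assume "l h \<noteq> inner v h"
    define p where "p = l h - inner v h"
    have p: "p \<noteq> 0" using \<open>l h \<noteq> inner v h\<close> by (simp add: p_def)
    have J': "J (v + t *\<^sub>R h) = J v + t\<^sup>2 * (norm h)\<^sup>2 - 2 * t * p" for t
      unfolding J_def power2_norm_eq_inner scaleR add p_def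
      by (simp add: inner_add inner_commute algebra_simps power2_eq_square)
    have "0 \<le> t\<^sup>2 * (norm h)\<^sup>2 - 2 * t * p" for t
      using J'[of t] m_le[of "v + t *\<^sub>R h"] \<open>J v \<le> m\<close> by simp
    \<comment> \<open>The quadratic in t is nonnegative everywhere, while its linear term would make
      it negative close to 0 on the side of p. The added 1 keeps the denominator positive for h =
      0.\<close>
    from this[of "p / (1 + (norm h)\<^sup>2)"]
    have "2 * p\<^sup>2 / (1 + (norm h)\<^sup>2) \<le> p\<^sup>2 * (norm h)\<^sup>2 / (1 + (norm h)\<^sup>2)\<^sup>2"
      by (simp add: power_divide power2_eq_square)
    also have "\<dots> \<le> p\<^sup>2 / (1 + (norm h)\<^sup>2)"
    proof -
      have q: "0 < 1 + (norm h)\<^sup>2" by (simp add: add_pos_nonneg)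
      have "p\<^sup>2 * (norm h)\<^sup>2 \<le> p\<^sup>2 * (1 + (norm h)\<^sup>2)" by (simp add: mult_left_mono)
      then have "p\<^sup>2 * (norm h)\<^sup>2 / (1 + (norm h)\<^sup>2)\<^sup>2 \<le> p\<^sup>2 * (1 + (norm h)\<^sup>2) / (1 + (norm h)\<^sup>2)\<^sup>2"
        by (rule divide_right_mono) simp
      also have "\<dots> = p\<^sup>2 / (1 + (norm h)\<^sup>2)" using q by (simp add: power2_eq_square)
      finally show ?thesis .
    qed
    finally have "2 * p\<^sup>2 / (1 + (norm h)\<^sup>2) \<le> p\<^sup>2 / (1 + (norm h)\<^sup>2)" .
    then have "2 * p\<^sup>2 \<le> p\<^sup>2"
      using add_pos_nonneg[OF zero_less_one zero_le_power2[of "norm h"]]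
      by (auto simp only: divide_le_cancel)
    then show False using p by simp
  qed
  then show ?thesis by (rule that)
qed

section \<open>Functions on the line with Hoelder continuous derivative\<close>

text \<open>The mean value theorem replaces integration of f'. It gives the constant L where
  integration would give L / (1 + \<alpha>); the larger value still fits under
  \<open>constA\<close>.\<close>

lemma hoelder_descent:
  fixes f f' :: "real \<Rightarrow> real"
  assumes deriv: "\<And>s. (f has_real_derivative f' s) (at s)"
    and hoelder: "\<And>s s'. \<bar>f' s - f' s'\<bar> \<le> L * \<bar>s - s'\<bar> powr \<alpha>" and "0 < \<alpha>" "0 \<le> L"
  shows "f s' \<le> f s + f' s * (s' - s) + L * \<bar>s' - s\<bar> powr (1 + \<alpha>)"
proof (cases "s = s'")
  case False
  obtain \<xi> where \<xi>: "f s' - f s = (s' - s) * f' \<xi>" "\<bar>\<xi> - s\<bar> \<le> \<bar>s' - s\<bar>"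
  proof (cases "s < s'")
    case True
    with MVT2[OF True, of f f'] deriv obtain \<xi> where "s < \<xi>" "\<xi> < s'" "f s' - f s = (s' - s) * f' \<xi>"
      by blast
    then show ?thesis by (intro that) auto
  next
    case False
    with \<open>s \<noteq> s'\<close> have "s' < s" by simp
    with MVT2[of s' s f f'] deriv obtain \<xi> where "s' < \<xi>" "\<xi> < s" "f s - f s' = (s - s') * f' \<xi>"
      by blast
    then show ?thesis by (intro that[of \<xi>]) (auto simp: algebra_simps)
  qed
  have "(s' - s) * (f' \<xi> - f' s) \<le> \<bar>s' - s\<bar> * \<bar>f' \<xi> - f' s\<bar>"
    by (metis abs_ge_self abs_mult)
  also have "\<dots> \<le> \<bar>s' - s\<bar> * (L * \<bar>s' - s\<bar> powr \<alpha>)"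
    using \<xi>(2) assms(3,4)
    by (intro mult_left_mono order_trans[OF hoelder] powr_mono2) auto
  also have "\<dots> = L * \<bar>s' - s\<bar> powr (1 + \<alpha>)"
    using False by (simp add: powr_add)
  finally show ?thesis using \<xi>(1) by (simp add: algebra_simps)
qed simp

text \<open>Trades the exponent 1 + \<alpha> for 2 at a free scale \<tau>: below \<tau> the constant
  suffices, and above it x^(\<alpha> - 1) is at most \<tau>^(\<alpha> - 1). A quadratic bound can be
  minimised explicitly.\<close>

lemma powr_le_quadratic:
  fixes x \<tau> \<alpha> :: real
  assumes "0 \<le> x" "0 < \<tau>" "0 < \<alpha>" "\<alpha> \<le> 1"
  shows "x powr (1 + \<alpha>) \<le> \<tau> powr (1 + \<alpha>) + \<tau> powr (\<alpha> - 1) * x\<^sup>2"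
proof (cases "x \<le> \<tau>")
  case True
  then have "x powr (1 + \<alpha>) \<le> \<tau> powr (1 + \<alpha>)" using assms by (intro powr_mono2) auto
  then show ?thesis by (simp add: add_increasing2)
next
  case False
  then have x: "0 < x" using assms by simp
  have "x powr (1 + \<alpha>) = x powr (\<alpha> - 1) * x powr 2" by (simp flip: powr_add)
  also have "\<dots> \<le> \<tau> powr (\<alpha> - 1) * x\<^sup>2"
    using False assms x by (intro mult_mono powr_mono2') (auto simp: powr_numeral)
  finally show ?thesis by (simp add: add_increasing)
qed

lemma hoelder_self_bounding:
  fixes f f' :: "real \<Rightarrow> real"
  assumes deriv: "\<And>s. (f has_real_derivative f' s) (at s)"
    and hoelder: "\<And>s s'. \<bar>f' s - f' s'\<bar> \<le> L * \<bar>s - s'\<bar> powr \<alpha>"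
    and \<alpha>: "0 < \<alpha>" "\<alpha> \<le> 1" and L: "0 < L" and \<tau>: "0 < \<tau>" and nonneg: "\<And>s. 0 \<le> f s"
  shows "(f' s)\<^sup>2 \<le> 4 * L * \<tau> powr (\<alpha> - 1) * (f s + L * \<tau> powr (1 + \<alpha>))"
proof -
  define c where "c = \<tau> powr (\<alpha> - 1)"
  have c: "0 < c" using \<tau> by (simp add: c_def)
  \<comment> \<open>compare with the minimum value of the upper bound on \<open>f\<close> provided by the descent inequality\<close>
  define h where "h = f' s / (2 * L * c)"
  have "0 \<le> f (s - h)" by (rule nonneg)
  also have "\<dots> \<le> f s + f' s * ((s - h) - s) + L * \<bar>(s - h) - s\<bar> powr (1 + \<alpha>)"
    using \<alpha> L by (intro hoelder_descent deriv hoelder) auto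
  also have "\<dots> \<le> f s - f' s * h + L * (\<tau> powr (1 + \<alpha>) + c * h\<^sup>2)"
    using powr_le_quadratic[of "\<bar>h\<bar>" \<tau> \<alpha>] \<alpha> L \<tau> by (simp add: c_def mult_left_mono)
  also have "\<dots> = f s + L * \<tau> powr (1 + \<alpha>) - (f' s)\<^sup>2 / (4 * L * c)"
    using L c by (simp add: h_def field_simps power2_eq_square)
  finally have "(f' s)\<^sup>2 / (4 * L * c) \<le> f s + L * \<tau> powr (1 + \<alpha>)" by simp
  then show ?thesis using L c by (simp add: c_def field_simps)
qed

lemma constA_pos: "0 < \<alpha> \<Longrightarrow> 0 < L \<Longrightarrow> 0 < constA \<alpha> L"
  by (simp add: constA_def)

text \<open>This is where the value of A enters. For \<alpha> = 1 the scale drops out and 4 L equals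
  A; otherwise 4 L \<tau>^(\<alpha> - 1) = A is solved for \<tau>, and the additive constant in the
  self-bounding inequality pays for this choice.\<close>

lemma exists_scale_le_constA:
  assumes "0 < \<alpha>" "\<alpha> \<le> 1" "0 < L"
  obtains \<tau> where "0 < \<tau>" "4 * L * \<tau> powr (\<alpha> - 1) \<le> constA \<alpha> L"
proof (cases "\<alpha> = 1")
  case True
  with assms show ?thesis by (intro that[of 1]) (auto simp: constA_def)
next
  case False
  define q where "q = constA \<alpha> L / (4 * L)"
  have q: "0 < q" using assms by (simp add: q_def constA_pos)
  have "(q powr (1 / (\<alpha> - 1))) powr (\<alpha> - 1) = q"
    using False q by (simp add: powr_powr)
  with q assms show ?thesis
    by (intro that[of "q powr (1 / (\<alpha> - 1))"]) (auto simp: q_def)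
qed

section \<open>The learning problem and its standing assumptions\<close>

text \<open>\<open>\<kappa>\<close> stands for any bound on the square root of K x x, and
  \<open>B\<close> bounds both reference losses at once. The step size condition is a product rather
  than a quotient so that it makes sense for \<open>\<kappa>\<close> = 0.\<close>

locale kernel_online_learning = prob_space \<rho>
  for \<rho> :: "('x::second_countable_topology \<times> real) measure" +
  fixes X :: "'x set" and Y :: "real set"
    and K :: "'x \<Rightarrow> 'x \<Rightarrow> real"
    and evl :: "'h::{real_inner,complete_space} \<Rightarrow> 'x \<Rightarrow> real"
    and Kx :: "'x \<Rightarrow> 'h"
    and \<phi> \<phi>' :: "real \<Rightarrow> real \<Rightarrow> real"
    and \<alpha> L \<kappa> B :: real
    and fH :: 'h
    and \<eta> :: "nat \<Rightarrow> real"
  assumes sets_rho: "sets \<rho> = sets (restrict_space borel (X \<times> Y))"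
    and K_cont: "continuous_on (X \<times> X) (\<lambda>(x, y). K x y)"
    and rkhs: "is_RKHS K X evl Kx"
    and K_diag: "\<And>x. x \<in> X \<Longrightarrow> K x x \<le> \<kappa>\<^sup>2" and kappa_nonneg: "0 \<le> \<kappa>"
    and phi_nonneg: "\<And>y s. y \<in> Y \<Longrightarrow> 0 \<le> \<phi> y s"
    and phi_deriv: "\<And>y s. y \<in> Y \<Longrightarrow> (\<phi> y has_real_derivative \<phi>' y s) (at s)"
    and phi_convex: "\<And>y. y \<in> Y \<Longrightarrow> convex_on UNIV (\<phi> y)"
    and alpha: "0 < \<alpha>" "\<alpha> \<le> 1" and L_pos: "0 < L"
    and hoelder: "\<And>y s s'. y \<in> Y \<Longrightarrow> \<bar>\<phi>' y s - \<phi>' y s'\<bar> \<le> L * \<bar>s - s'\<bar> powr \<alpha>"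
    and phi_meas: "(\<lambda>(y, s). \<phi> y s) \<in> borel_measurable (restrict_space borel (Y \<times> UNIV))"
    and phi'_meas: "(\<lambda>(y, s). \<phi>' y s) \<in> borel_measurable (restrict_space borel (Y \<times> UNIV))"
    and fH_min: "\<And>f. gen_err \<rho> \<phi> (evl fH) \<le> gen_err \<rho> \<phi> (evl f)"
    and phi_0_le: "\<And>y. y \<in> Y \<Longrightarrow> \<phi> y 0 \<le> B"
    and phi_fH_le: "\<And>x y. x \<in> X \<Longrightarrow> y \<in> Y \<Longrightarrow> \<phi> y (evl fH x) \<le> B"
    and eta_pos: "\<And>t. 1 \<le> t \<Longrightarrow> 0 < \<eta> t"
    and eta_le: "\<And>t. 1 \<le> t \<Longrightarrow> \<eta> t * (constA \<alpha> L * \<kappa>\<^sup>2) \<le> 1"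
    and eta_mono: "\<And>t. 1 \<le> t \<Longrightarrow> \<eta> (Suc t) \<le> \<eta> t"
    and eta_sq: "summable (\<lambda>t. (\<eta> (Suc t))\<^sup>2)"
begin

lemma space_rho: "space \<rho> = X \<times> Y"
  using sets_eq_imp_space_eq[OF sets_rho] by (simp add: space_restrict_space)

lemma space_rhoD: "z \<in> space \<rho> \<Longrightarrow> fst z \<in> X" "z \<in> space \<rho> \<Longrightarrow> snd z \<in> Y"
  by (auto simp: space_rho)

lemma B_nonneg: "0 \<le> B"
proof -
  obtain z where "z \<in> space \<rho>" using not_empty by auto
  then show ?thesis using phi_nonneg[of "snd z" 0] phi_0_le[of "snd z"] by (auto simp: space_rho)
qed

lemma evl_inner: "x \<in> X \<Longrightarrow> evl f x = inner f (Kx x)"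
  using rkhs unfolding is_RKHS_def by blast

lemma inner_Kx:
  assumes "x \<in> X" "y \<in> X"
  shows "inner (Kx x) (Kx y) = K x y"
proof -
  have "evl (Kx x) y = K x y" using rkhs assms unfolding is_RKHS_def by blast
  then show ?thesis using evl_inner[OF assms(2)] by simp
qed

lemma norm_Kx_sq: "x \<in> X \<Longrightarrow> (norm (Kx x))\<^sup>2 = K x x"
  by (simp add: power2_norm_eq_inner inner_Kx)

lemma norm_Kx_le:
  assumes "x \<in> X"
  shows "norm (Kx x) \<le> \<kappa>"
  using K_diag[OF assms] kappa_nonneg norm_Kx_sq[OF assms] by (auto intro: power2_le_imp_le)

lemma abs_evl_le: "x \<in> X \<Longrightarrow> \<bar>evl f x\<bar> \<le> \<kappa> * norm f"
  using Cauchy_Schwarz_ineq2[of f "Kx x"] mult_right_mono[OF norm_Kx_le[of x] norm_ge_zero[of f]]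
  by (simp add: evl_inner mult.commute)

lemma abs_K_le: "x \<in> X \<Longrightarrow> y \<in> X \<Longrightarrow> \<bar>K x y\<bar> \<le> \<kappa>\<^sup>2"
  using Cauchy_Schwarz_ineq2[of "Kx x" "Kx y"]
    mult_mono[OF norm_Kx_le[of x] norm_Kx_le[of y] kappa_nonneg norm_ge_zero]
  by (simp add: inner_Kx power2_eq_square)

lemma K_diag_nonneg: "x \<in> X \<Longrightarrow> 0 \<le> K x x"
  by (simp flip: norm_Kx_sq)

text \<open>The squared distance of two kernel sections is K x x - 2 K x y + K y y, which tends to 0
  as y tends to x. Continuity, hence measurability, of every function in the space follows.\<close>

lemma continuous_on_Kx: "continuous_on X Kx"
  unfolding continuous_on_def
proof
  fix x assume x: "x \<in> X"
  have K1: "continuous_on X (\<lambda>y. K y y)" and K2: "continuous_on X (\<lambda>y. K x y)"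
    using continuous_on_compose2[OF K_cont, of X "\<lambda>y. (y, y)"]
      continuous_on_compose2[OF K_cont, of X "\<lambda>y. (x, y)"] x
    by (auto simp: image_subset_iff continuous_on_Pair)
  have "((\<lambda>y. sqrt (K x x - 2 * K x y + K y y)) \<longlongrightarrow> sqrt (K x x - 2 * K x x + K x x)) (at x within X)"
    using K1 K2 x by (intro tendsto_intros) (auto simp: continuous_on_def)
  then have "((\<lambda>y. sqrt (K x x - 2 * K x y + K y y)) \<longlongrightarrow> 0) (at x within X)"
    by simp
  moreover have "\<forall>\<^sub>F y in at x within X. sqrt (K x x - 2 * K x y + K y y) = dist (Kx y) (Kx x)"
    unfolding eventually_at_topological
  proof (intro exI[of _ UNIV] conjI ballI impI; simp?)
    fix y assume "y \<in> X"
    have "(dist (Kx y) (Kx x))\<^sup>2 = inner (Kx x) (Kx x) - 2 * inner (Kx x) (Kx y) + inner (Kx y) (Kx y)"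
      by (simp add: dist_norm power2_norm_eq_inner inner_diff inner_commute)
    then show "sqrt (K x x - 2 * K x y + K y y) = dist (Kx y) (Kx x)"
      using x \<open>y \<in> X\<close> by (intro real_sqrt_unique) (simp_all add: inner_Kx)
  qed
  ultimately show "(Kx \<longlongrightarrow> Kx x) (at x within X)"
    unfolding tendsto_dist_iff[of Kx] by (blast intro: Lim_transform_eventually)
qed

lemma continuous_on_evl: "continuous_on X (evl f)"
  using continuous_on_inner[OF continuous_on_const continuous_on_Kx, of f]
  by (simp add: evl_inner cong: continuous_on_cong)

subsection \<open>Measurability\<close>

context
  fixes N :: "'n measure" and u :: "'n \<Rightarrow> 'x \<times> real"
  assumes u: "u \<in> N \<rightarrow>\<^sub>M \<rho>"
begin

lemma sample_borel: "u \<in> borel_measurable N" "u \<in> space N \<rightarrow> X \<times> Y"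
  using u unfolding measurable_cong_sets[OF refl sets_rho] measurable_restrict_space2_iff by auto

lemma sample_fst: "(\<lambda>w. fst (u w)) \<in> N \<rightarrow>\<^sub>M restrict_space borel X"
proof (rule measurable_restrict_space2)
  show "(\<lambda>w. fst (u w)) \<in> space N \<rightarrow> X"
    using sample_borel(2) by (auto simp: mem_Times_iff Pi_iff)
qed (intro measurable_compose[OF sample_borel(1)] borel_measurable_continuous_onI continuous_intros)

lemma measurable_loss [measurable (raw)]:
  assumes "v \<in> borel_measurable N"
  shows "(\<lambda>w. \<phi> (snd (u w)) (v w)) \<in> borel_measurable N"
    and "(\<lambda>w. \<phi>' (snd (u w)) (v w)) \<in> borel_measurable N"
proof -
  have "(\<lambda>w. snd (u w)) \<in> borel_measurable N"
    by (intro measurable_compose[OF sample_borel(1)] borel_measurable_continuous_onI continuous_intros)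
  then have *: "(\<lambda>w. (snd (u w), v w)) \<in> N \<rightarrow>\<^sub>M restrict_space borel (Y \<times> UNIV)"
    using sample_borel(2) assms
    by (intro measurable_restrict_space2 borel_measurable_Pair) (auto simp: mem_Times_iff Pi_iff)
  from measurable_compose[OF * phi_meas] show "(\<lambda>w. \<phi> (snd (u w)) (v w)) \<in> borel_measurable N" by simp
  from measurable_compose[OF * phi'_meas] show "(\<lambda>w. \<phi>' (snd (u w)) (v w)) \<in> borel_measurable N" by simp
qed

lemma measurable_evl [measurable (raw)]: "(\<lambda>w. evl f (fst (u w))) \<in> borel_measurable N"
  by (rule measurable_compose[OF sample_fst borel_measurable_continuous_on_restrict[OF continuous_on_evl]])

end

lemma measurable_kernel [measurable (raw)]:
  assumes "u \<in> N \<rightarrow>\<^sub>M \<rho>" "v \<in> N \<rightarrow>\<^sub>M \<rho>"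
  shows "(\<lambda>w. K (fst (u w)) (fst (v w))) \<in> borel_measurable N"
proof -
  have "(\<lambda>w. (fst (u w), fst (v w))) \<in> N \<rightarrow>\<^sub>M restrict_space borel (X \<times> X)"
    using sample_fst[OF assms(1)] sample_fst[OF assms(2)] unfolding measurable_restrict_space2_iff
    by (auto intro: borel_measurable_Pair)
  from measurable_compose[OF this borel_measurable_continuous_on_restrict[OF K_cont]]
  show ?thesis by simp
qed

text \<open>Index shift: \<open>iter h n\<close> is the iterate f_{n+1}, a function of the samples 1
  to n. Step t therefore acts on \<open>iter h (t - 1)\<close> with the fresh sample
  \<open>h t\<close>.\<close>

abbreviation iter :: "(nat \<Rightarrow> 'x \<times> real) \<Rightarrow> nat \<Rightarrow> 'h" where
  "iter h n \<equiv> ogd \<phi>' evl Kx \<eta> h n"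

definition grad_weight :: "(nat \<Rightarrow> 'x \<times> real) \<Rightarrow> nat \<Rightarrow> real" where
  "grad_weight h n = \<phi>' (snd (h (Suc n))) (evl (iter h n) (fst (h (Suc n))))"

lemma iter_Suc: "iter h (Suc n) = iter h n - (\<eta> (Suc n) * grad_weight h n) *\<^sub>R Kx (fst (h (Suc n)))"
  by (simp add: grad_weight_def)

lemma iter_cong: "(\<And>i. 1 \<le> i \<Longrightarrow> i \<le> n \<Longrightarrow> h i = h' i) \<Longrightarrow> iter h n = iter h' n"
  by (induction n) auto

lemma evl_iter_Suc:
  assumes "x \<in> X" "fst (h (Suc n)) \<in> X"
  shows "evl (iter h (Suc n)) x = evl (iter h n) x - \<eta> (Suc n) * grad_weight h n * K (fst (h (Suc n))) x"
  using assms unfolding iter_Suc by (simp add: evl_inner inner_diff_left inner_Kx)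

text \<open>The point of evaluation is a random element u, generalised in the induction because one
  step needs the old iterate both at u and at the newest input. On the product of a sample space
  with \<rho> this yields joint measurability, so that risks and gradients are measurable as
  parameter integrals.\<close>

lemma measurable_evl_iter [measurable (raw)]:
  assumes "\<And>i. 1 \<le> i \<Longrightarrow> i \<le> n \<Longrightarrow> (\<lambda>w. h w i) \<in> N \<rightarrow>\<^sub>M \<rho>" and "u \<in> N \<rightarrow>\<^sub>M \<rho>"
  shows "(\<lambda>w. evl (iter (h w) n) (fst (u w))) \<in> borel_measurable N"
  using assms
proof (induction n arbitrary: u)
  case 0
  have "(\<lambda>w. evl 0 (fst (u w))) \<in> borel_measurable N" using 0(2) by measurable
  then show ?case by simp
next
  case (Suc n)
  have h[measurable]: "(\<lambda>w. h w (Suc n)) \<in> N \<rightarrow>\<^sub>M \<rho>" and u[measurable]: "u \<in> N \<rightarrow>\<^sub>M \<rho>"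
    using Suc.prems by auto
  have [measurable]: "(\<lambda>w. evl (iter (h w) n) (fst (h w (Suc n)))) \<in> borel_measurable N"
    "(\<lambda>w. evl (iter (h w) n) (fst (u w))) \<in> borel_measurable N"
    using Suc h u by auto
  have "(\<lambda>w. evl (iter (h w) n) (fst (u w)) - \<eta> (Suc n) * grad_weight (h w) n * K (fst (h w (Suc n))) (fst (u w)))
      \<in> borel_measurable N"
    unfolding grad_weight_def by measurable
  then show ?case
    using measurable_space[OF h] measurable_space[OF u] by (subst measurable_cong[OF evl_iter_Suc]) (auto dest: space_rhoD)
qed

section \<open>Real functionals of an iterate and their measurability\<close>

definition dist_sq :: "'h \<Rightarrow> real" where
  "dist_sq f = (norm (f - fH))\<^sup>2"

definition excess_loss :: "'h \<Rightarrow> 'x \<times> real \<Rightarrow> real" where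
  "excess_loss f z = \<phi> (snd z) (evl f (fst z)) - \<phi> (snd z) (evl fH (fst z))"

definition excess_risk :: "'h \<Rightarrow> real" where
  "excess_risk f = (\<integral>z. excess_loss f z \<partial>\<rho>)"

text \<open>\<open>risk_grad f x\<close> is the inner product of the gradient of the risk at \<open>f\<close> with \<open>Kx x\<close>, and
  \<open>grad_sq f\<close> is the squared norm of that gradient; these integrals avoid \<open>'h\<close>-valued integration.\<close>
definition risk_grad :: "'h \<Rightarrow> 'x \<Rightarrow> real" where
  "risk_grad f x = (\<integral>z. \<phi>' (snd z) (evl f (fst z)) * K (fst z) x \<partial>\<rho>)"

definition grad_sq :: "'h \<Rightarrow> real" where
  "grad_sq f = (\<integral>z. \<phi>' (snd z) (evl f (fst z)) * risk_grad f (fst z) \<partial>\<rho>)"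

lemma dist_sq_nonneg: "0 \<le> dist_sq f"
  by (simp add: dist_sq_def)

text \<open>Expanding the square leaves only values of functions at the new input, so the distance
  to \<open>fH\<close> obeys a real recursion. This starts the norm estimate and also makes the
  distance measurable.\<close>

lemma dist_sq_iter_Suc:
  assumes "fst (h (Suc n)) \<in> X"
  shows "dist_sq (iter h (Suc n)) = dist_sq (iter h n)
    - 2 * \<eta> (Suc n) * (grad_weight h n * (evl (iter h n) (fst (h (Suc n))) - evl fH (fst (h (Suc n)))))
    + (\<eta> (Suc n))\<^sup>2 * (grad_weight h n)\<^sup>2 * K (fst (h (Suc n))) (fst (h (Suc n)))"
proof -
  define a where "a = \<eta> (Suc n) * grad_weight h n"
  define f where "f = iter h n"
  define k where "k = Kx (fst (h (Suc n)))"
  have "dist_sq (f - a *\<^sub>R k) = dist_sq f - 2 * a * inner (f - fH) k + a\<^sup>2 * inner k k"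
    unfolding dist_sq_def power2_norm_eq_inner
    by (simp add: inner_diff inner_commute algebra_simps power2_eq_square)
  moreover have "inner (f - fH) k = evl f (fst (h (Suc n))) - evl fH (fst (h (Suc n)))"
    "inner k k = K (fst (h (Suc n))) (fst (h (Suc n)))"
    using assms by (simp_all add: k_def evl_inner inner_diff_left inner_Kx)
  moreover have "iter h (Suc n) = f - a *\<^sub>R k"
    unfolding iter_Suc by (simp add: a_def f_def k_def)
  ultimately show ?thesis
    by (simp only: a_def f_def power_mult_distrib mult.assoc)
qed

context
  fixes N :: "'n measure" and h :: "'n \<Rightarrow> nat \<Rightarrow> 'x \<times> real" and n :: nat
  assumes h: "\<And>i. 1 \<le> i \<Longrightarrow> i \<le> n \<Longrightarrow> (\<lambda>w. h w i) \<in> N \<rightarrow>\<^sub>M \<rho>"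
begin

lemma measurable_excess_loss_iter [measurable (raw)]:
  "u \<in> N \<rightarrow>\<^sub>M \<rho> \<Longrightarrow> (\<lambda>w. excess_loss (iter (h w) n) (u w)) \<in> borel_measurable N"
  unfolding excess_loss_def
  by (intro borel_measurable_diff measurable_loss measurable_evl_iter measurable_evl h)

lemma measurable_pair_samples:
  "1 \<le> i \<Longrightarrow> i \<le> n \<Longrightarrow> (\<lambda>p. h (fst p) i) \<in> N \<Otimes>\<^sub>M \<rho> \<rightarrow>\<^sub>M \<rho>"
  using h by (rule measurable_compose[OF measurable_fst])

lemma measurable_evl_iter_pair [measurable]:
  "(\<lambda>p. evl (iter (h (fst p)) n) (fst (snd p))) \<in> borel_measurable (N \<Otimes>\<^sub>M \<rho>)"
  by (rule measurable_evl_iter[OF measurable_pair_samples]) measurable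

lemma measurable_excess_risk_iter [measurable (raw)]:
  "(\<lambda>w. excess_risk (iter (h w) n)) \<in> borel_measurable N"
  unfolding excess_risk_def excess_loss_def
  by (rule borel_measurable_lebesgue_integral) (simp add: case_prod_beta')

lemma measurable_dist_sq_iter [measurable (raw)]:
  "(\<lambda>w. dist_sq (iter (h w) n)) \<in> borel_measurable N"
  using h
proof (induction n)
  case (Suc n)
  have [measurable]: "(\<lambda>w. h w (Suc n)) \<in> N \<rightarrow>\<^sub>M \<rho>" using Suc.prems by auto
  have [measurable]: "(\<lambda>w. dist_sq (iter (h w) n)) \<in> borel_measurable N" using Suc by auto
  have [measurable]: "(\<lambda>w. evl (iter (h w) n) (fst (h w (Suc n)))) \<in> borel_measurable N"
    using Suc.prems by (intro measurable_evl_iter) auto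
  have X: "fst (h w (Suc n)) \<in> X" if "w \<in> space N" for w
    using measurable_space[OF Suc.prems that] by (auto dest: space_rhoD)
  let ?g = "\<lambda>w. dist_sq (iter (h w) n)
    - 2 * \<eta> (Suc n) * (grad_weight (h w) n * (evl (iter (h w) n) (fst (h w (Suc n))) - evl fH (fst (h w (Suc n)))))
    + (\<eta> (Suc n))\<^sup>2 * (grad_weight (h w) n)\<^sup>2 * K (fst (h w (Suc n))) (fst (h w (Suc n)))"
  have "?g \<in> borel_measurable N"
    unfolding grad_weight_def by measurable
  also have "?this \<longleftrightarrow> ?case"
    by (intro measurable_cong dist_sq_iter_Suc[symmetric] X)
  finally show ?case .
qed simp

end

lemma measurable_risk_grad_iter [measurable (raw)]:
  assumes h: "\<And>i. 1 \<le> i \<Longrightarrow> i \<le> n \<Longrightarrow> (\<lambda>w. h w i) \<in> N \<rightarrow>\<^sub>M \<rho>"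
    and [measurable]: "u \<in> N \<rightarrow>\<^sub>M \<rho>"
  shows "(\<lambda>w. risk_grad (iter (h w) n) (fst (u w))) \<in> borel_measurable N"
proof -
  note [measurable] = measurable_evl_iter_pair[OF h]
  show ?thesis
    unfolding risk_grad_def by (rule borel_measurable_lebesgue_integral) (simp add: case_prod_beta')
qed

lemma measurable_grad_sq_iter [measurable (raw)]:
  assumes h: "\<And>i. 1 \<le> i \<Longrightarrow> i \<le> n \<Longrightarrow> (\<lambda>w. h w i) \<in> N \<rightarrow>\<^sub>M \<rho>"
  shows "(\<lambda>w. grad_sq (iter (h w) n)) \<in> borel_measurable N"
proof -
  note [measurable] = measurable_evl_iter_pair[OF h]
  have [measurable]: "(\<lambda>p. risk_grad (iter (h (fst p)) n) (fst (snd p))) \<in> borel_measurable (N \<Otimes>\<^sub>M \<rho>)"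
    by (rule measurable_risk_grad_iter[OF measurable_pair_samples[OF h]]) measurable
  show ?thesis
    unfolding grad_sq_def by (rule borel_measurable_lebesgue_integral) (simp add: case_prod_beta')
qed

subsection \<open>Bounds on the loss and on the risk\<close>

abbreviation A :: real where "A \<equiv> constA \<alpha> L"

text \<open>Chosen by \<open>SOME\<close> because the natural value depends on a scale \<tau> that
  is only known to exist. Subtracting B lets the inequality pass to excess losses, since B bounds
  the loss of \<open>fH\<close>.\<close>

definition noise :: real where
  "noise = (SOME b. 0 \<le> b \<and> (\<forall>y\<in>Y. \<forall>s. (\<phi>' y s)\<^sup>2 \<le> A * (\<phi> y s - B) + b))"

lemma A_pos: "0 < A"
  using alpha L_pos by (simp add: constA_pos)

lemma noise: "0 \<le> noise" "y \<in> Y \<Longrightarrow> (\<phi>' y s)\<^sup>2 \<le> A * (\<phi> y s - B) + noise"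
proof -
  obtain \<tau> where \<tau>: "0 < \<tau>" "4 * L * \<tau> powr (\<alpha> - 1) \<le> A"
    using exists_scale_le_constA alpha L_pos by blast
  have "(\<phi>' y s)\<^sup>2 \<le> A * (\<phi> y s - B) + A * (B + L * \<tau> powr (1 + \<alpha>))" if "y \<in> Y" for y s
  proof -
    have "(\<phi>' y s)\<^sup>2 \<le> 4 * L * \<tau> powr (\<alpha> - 1) * (\<phi> y s + L * \<tau> powr (1 + \<alpha>))"
      using that alpha L_pos \<tau> by (intro hoelder_self_bounding phi_deriv hoelder phi_nonneg)
    also have "\<dots> \<le> A * (\<phi> y s + L * \<tau> powr (1 + \<alpha>))"
      using \<tau> L_pos phi_nonneg[OF that, of s] by (intro mult_right_mono add_nonneg_nonneg) auto
    finally show ?thesis by (simp add: algebra_simps)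
  qed
  moreover have "0 \<le> A * (B + L * \<tau> powr (1 + \<alpha>))"
    using A_pos B_nonneg L_pos by simp
  ultimately have "\<exists>b. 0 \<le> b \<and> (\<forall>y\<in>Y. \<forall>s. (\<phi>' y s)\<^sup>2 \<le> A * (\<phi> y s - B) + b)"
    by blast
  from someI_ex[OF this] show "0 \<le> noise" "y \<in> Y \<Longrightarrow> (\<phi>' y s)\<^sup>2 \<le> A * (\<phi> y s - B) + noise"
    unfolding noise_def by blast+
qed

text \<open>Linear growth constant of \<phi>': \<open>sqrt noise\<close> bounds |\<phi>' y 0|, the
  change from 0 to s is at most L (1 + |s|), and the last factor converts |s| into the distance from
  \<open>fH\<close>.\<close>

definition G :: real where
  "G = (sqrt noise + L) * (1 + \<kappa> * norm fH + \<kappa>)"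

lemma G_nonneg: "0 \<le> G"
  using noise(1) L_pos kappa_nonneg by (simp add: G_def)

lemma abs_phi'_le:
  assumes "x \<in> X" "y \<in> Y"
  shows "\<bar>\<phi>' y (evl f x)\<bar> \<le> G * (1 + norm (f - fH))"
proof -
  define s where "s = evl f x"
  define \<nu> where "\<nu> = norm (f - fH)"
  have "(\<phi>' y 0)\<^sup>2 \<le> noise"
    using noise(2)[OF assms(2), of 0] phi_0_le[OF assms(2)] A_pos
    by (smt (verit) mult_nonneg_nonpos)
  then have "\<bar>\<phi>' y 0\<bar> \<le> sqrt noise" by (simp add: real_le_rsqrt)
  moreover have "\<bar>\<phi>' y s - \<phi>' y 0\<bar> \<le> L * (1 + \<bar>s\<bar>)"
  proof -
    have "\<bar>s\<bar> powr \<alpha> \<le> 1 + \<bar>s\<bar>"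
    proof (cases "\<bar>s\<bar> \<le> 1")
      case True
      then have "\<bar>s\<bar> powr \<alpha> \<le> 1" using alpha by (simp add: powr_le1)
      then show ?thesis by simp
    next
      case False
      then have "\<bar>s\<bar> powr \<alpha> \<le> \<bar>s\<bar> powr 1" using alpha by (intro powr_mono) auto
      then show ?thesis by simp
    qed
    then show ?thesis
      using hoelder[OF assms(2), of s 0] L_pos by (smt (verit) mult_left_mono)
  qed
  ultimately have "\<bar>\<phi>' y s\<bar> \<le> (sqrt noise + L) * (1 + \<bar>s\<bar>)"
    using noise(1) by (simp add: algebra_simps) (smt (verit) mult_nonneg_nonneg real_sqrt_ge_zero abs_ge_zero)
  also have "\<dots> \<le> (sqrt noise + L) * ((1 + \<kappa> * norm fH + \<kappa>) * (1 + \<nu>))"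
  proof (rule mult_left_mono)
    have "\<bar>s\<bar> \<le> \<kappa> * norm f" using abs_evl_le[OF assms(1)] by (simp add: s_def)
    also have "\<dots> \<le> \<kappa> * (norm fH + \<nu>)"
      unfolding \<nu>_def using kappa_nonneg norm_triangle_ineq2[of f fH] by (intro mult_left_mono) auto
    finally have "1 + \<bar>s\<bar> \<le> 1 + \<kappa> * norm fH + \<kappa> * \<nu>" by (simp add: algebra_simps)
    also have "\<dots> \<le> (1 + \<kappa> * norm fH + \<kappa>) * (1 + \<nu>)"
      using kappa_nonneg by (simp add: algebra_simps \<nu>_def)
    finally show "1 + \<bar>s\<bar> \<le> (1 + \<kappa> * norm fH + \<kappa>) * (1 + \<nu>)" .
  qed (use noise(1) L_pos in simp)
  finally show ?thesis by (simp add: G_def s_def \<nu>_def mult.assoc)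
qed

lemma norm_le_of_dist_sq: "dist_sq f \<le> R \<Longrightarrow> norm (f - fH) \<le> sqrt R"
  unfolding dist_sq_def by (rule real_le_rsqrt)

lemma phi'_sq_le:
  assumes "x \<in> X" "y \<in> Y" "dist_sq f \<le> R" "1 \<le> R"
  shows "(\<phi>' y (evl f x))\<^sup>2 \<le> 4 * G\<^sup>2 * R"
proof -
  have "1 + norm (f - fH) \<le> 2 * sqrt R"
    using norm_le_of_dist_sq[OF assms(3)] real_sqrt_ge_one[OF assms(4)] by linarith
  then have "\<bar>\<phi>' y (evl f x)\<bar> \<le> G * (2 * sqrt R)"
    using G_nonneg by (intro order_trans[OF abs_phi'_le[OF assms(1,2)]] mult_left_mono)
  then have "\<bar>\<phi>' y (evl f x)\<bar>\<^sup>2 \<le> (G * (2 * sqrt R))\<^sup>2"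
    by (rule power_mono) simp
  then show ?thesis using assms(4) by (simp add: power_mult_distrib)
qed

lemma abs_evl_diff_le:
  assumes "x \<in> X"
  shows "\<bar>evl f x - evl fH x\<bar> \<le> \<kappa> * norm (f - fH)"
proof -
  have "evl f x - evl fH x = evl (f - fH) x" using assms by (simp add: evl_inner inner_diff_left)
  then show ?thesis using abs_evl_le[OF assms] by simp
qed

lemma phi_tangent: "y \<in> Y \<Longrightarrow> \<phi>' y s * (s' - s) \<le> \<phi> y s' - \<phi> y s"
  using convex_on_imp_above_tangent[OF phi_convex[of y], of s s' "\<phi>' y s"] phi_deriv[of y s] by simp

text \<open>The tangents at f and at \<open>fH\<close> enclose the excess loss. Both carry the
  factor f(x) - fH(x), so its size is that of a derivative times a distance.\<close>

lemma excess_loss_tangent: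
  assumes "z \<in> space \<rho>"
  shows "excess_loss f z \<le> \<phi>' (snd z) (evl f (fst z)) * (evl f (fst z) - evl fH (fst z))"
    and "\<phi>' (snd z) (evl fH (fst z)) * (evl f (fst z) - evl fH (fst z)) \<le> excess_loss f z"
  using phi_tangent[OF space_rhoD(2)[OF assms], of "evl f (fst z)" "evl fH (fst z)"]
    phi_tangent[OF space_rhoD(2)[OF assms], of "evl fH (fst z)" "evl f (fst z)"]
  by (auto simp: excess_loss_def algebra_simps)

lemma excess_loss_ge: "z \<in> space \<rho> \<Longrightarrow> - B \<le> excess_loss f z"
  using phi_nonneg[OF space_rhoD(2), of z "evl f (fst z)"] phi_fH_le[OF space_rhoD, of z z]
  by (simp add: excess_loss_def)

lemma phi'_sq_le_excess_loss:
  assumes "z \<in> space \<rho>"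
  shows "(\<phi>' (snd z) (evl f (fst z)))\<^sup>2 \<le> A * excess_loss f z + noise"
proof -
  have "A * (\<phi> (snd z) (evl f (fst z)) - B) \<le> A * excess_loss f z"
    using A_pos phi_fH_le[OF space_rhoD[OF assms]] by (simp add: excess_loss_def)
  then show ?thesis using noise(2)[OF space_rhoD(2)[OF assms], of "evl f (fst z)"] by linarith
qed

lemma abs_excess_loss_le:
  assumes "z \<in> space \<rho>" "dist_sq f \<le> R" "1 \<le> R"
  shows "\<bar>excess_loss f z\<bar> \<le> 2 * \<kappa> * G * R"
proof -
  define w where "w = evl f (fst z) - evl fH (fst z)"
  have w: "\<bar>w\<bar> \<le> \<kappa> * sqrt R"
    using abs_evl_diff_le[OF space_rhoD(1)[OF assms(1)], of f]
      mult_left_mono[OF norm_le_of_dist_sq[OF assms(2)] kappa_nonneg] by (simp add: w_def)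
  have *: "\<bar>\<phi>' (snd z) (evl f' (fst z))\<bar> \<le> G * (2 * sqrt R)" if "dist_sq f' \<le> R" for f'
  proof -
    have "1 + norm (f' - fH) \<le> 2 * sqrt R"
      using norm_le_of_dist_sq[OF that] real_sqrt_ge_one[OF assms(3)] by linarith
    then show ?thesis
      using G_nonneg by (intro order_trans[OF abs_phi'_le[OF space_rhoD[OF assms(1)]]] mult_left_mono)
  qed
  have prod: "\<bar>\<phi>' (snd z) (evl f' (fst z)) * w\<bar> \<le> 2 * \<kappa> * G * R" if "dist_sq f' \<le> R" for f'
  proof -
    have "\<bar>\<phi>' (snd z) (evl f' (fst z)) * w\<bar> \<le> (G * (2 * sqrt R)) * (\<kappa> * sqrt R)"
      unfolding abs_mult using *[OF that] w G_nonneg assms(3) by (intro mult_mono) auto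
    also have "\<dots> = 2 * \<kappa> * G * R" using assms(3) by simp
    finally show ?thesis .
  qed
  have "dist_sq fH \<le> R" using assms(3) by (simp add: dist_sq_def)
  then show ?thesis
    using excess_loss_tangent[OF assms(1), of f] prod[OF assms(2)] prod[of fH] unfolding w_def by linarith
qed

text \<open>The variance estimate that makes absorption possible. By the two tangents the square is
  a squared difference of values, at most \<kappa>^2 times the squared distance, times a squared
  derivative. Self-bounding makes the latter linear in the excess loss; at \<open>fH\<close> it is
  at most \<open>noise\<close>, the excess loss there being 0.\<close>

lemma excess_loss_sq_le:
  assumes "z \<in> space \<rho>"
  shows "(excess_loss f z)\<^sup>2 \<le> \<kappa>\<^sup>2 * dist_sq f * (A * excess_loss f z + 2 * noise)"
proof -
  define w where "w = evl f (fst z) - evl fH (fst z)"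
  define g where "g f' = \<phi>' (snd z) (evl f' (fst z))" for f'
  have g: "(g f)\<^sup>2 \<le> A * excess_loss f z + noise" "(g fH)\<^sup>2 \<le> noise"
    using phi'_sq_le_excess_loss[OF assms, of f] phi'_sq_le_excess_loss[OF assms, of fH]
    by (simp_all add: g_def excess_loss_def)
  have "\<bar>w\<bar>\<^sup>2 \<le> (\<kappa> * norm (f - fH))\<^sup>2"
    unfolding w_def by (intro power_mono abs_evl_diff_le space_rhoD assms) simp
  then have w: "w\<^sup>2 \<le> \<kappa>\<^sup>2 * dist_sq f" by (simp add: power_mult_distrib dist_sq_def)
  have "\<bar>excess_loss f z\<bar> \<le> \<bar>g f * w\<bar> \<or> \<bar>excess_loss f z\<bar> \<le> \<bar>g fH * w\<bar>"
    using excess_loss_tangent[OF assms, of f] unfolding w_def[symmetric] g_def[symmetric] by linarith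
  then have "(excess_loss f z)\<^sup>2 \<le> (g f * w)\<^sup>2 \<or> (excess_loss f z)\<^sup>2 \<le> (g fH * w)\<^sup>2"
    by (simp only: abs_le_square_iff)
  then have "(excess_loss f z)\<^sup>2 \<le> w\<^sup>2 * ((g f)\<^sup>2 + (g fH)\<^sup>2)"
    by (auto simp: power_mult_distrib algebra_simps intro: order_trans)
  also have "\<dots> \<le> (\<kappa>\<^sup>2 * dist_sq f) * (A * excess_loss f z + 2 * noise)"
    using g w dist_sq_nonneg by (intro mult_mono) auto
  finally show ?thesis .
qed

lemma ident_sample: "(\<lambda>z. z) \<in> \<rho> \<rightarrow>\<^sub>M \<rho>"
  by simp

lemma measurable_excess_loss [measurable]: "excess_loss f \<in> borel_measurable \<rho>"
  unfolding excess_loss_def[abs_def]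
  by (intro borel_measurable_diff measurable_loss measurable_evl ident_sample)

lemma measurable_deriv_loss [measurable]: "(\<lambda>z. \<phi>' (snd z) (evl f (fst z))) \<in> borel_measurable \<rho>"
  by (intro measurable_loss measurable_evl ident_sample)

lemma dist_sq_bound: "dist_sq f \<le> max 1 (dist_sq f)" "1 \<le> max 1 (dist_sq f)"
  by auto

lemma integrable_excess_loss [simp]: "integrable \<rho> (excess_loss f)"
  using abs_excess_loss_le[OF _ dist_sq_bound] by (intro bounded_expectation(1)) auto

lemma integrable_loss_fH [simp]: "integrable \<rho> (\<lambda>z. \<phi> (snd z) (evl fH (fst z)))"
  using phi_nonneg phi_fH_le
  by (intro bounded_expectation(1)[where b = B] measurable_loss measurable_evl ident_sample)
    (auto simp: space_rho)

lemma gen_err_eq_integral: "gen_err \<rho> \<phi> (evl f) = ennreal (\<integral>z. \<phi> (snd z) (evl f (fst z)) \<partial>\<rho>)"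
  and excess_risk_eq: "excess_risk f =
    (\<integral>z. \<phi> (snd z) (evl f (fst z)) \<partial>\<rho>) - (\<integral>z. \<phi> (snd z) (evl fH (fst z)) \<partial>\<rho>)"
proof -
  have eq: "\<phi> (snd z) (evl f (fst z)) = excess_loss f z + \<phi> (snd z) (evl fH (fst z))" for z
    by (simp add: excess_loss_def)
  have "integrable \<rho> (\<lambda>z. \<phi> (snd z) (evl f (fst z)))"
    unfolding eq by (intro Bochner_Integration.integrable_add) simp_all
  then show "gen_err \<rho> \<phi> (evl f) = ennreal (\<integral>z. \<phi> (snd z) (evl f (fst z)) \<partial>\<rho>)"
    unfolding gen_err_def by (intro nn_integral_eq_integral AE_I2) (auto intro: phi_nonneg dest: space_rhoD)
  show "excess_risk f =
    (\<integral>z. \<phi> (snd z) (evl f (fst z)) \<partial>\<rho>) - (\<integral>z. \<phi> (snd z) (evl fH (fst z)) \<partial>\<rho>)"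
    unfolding excess_risk_def eq by (subst Bochner_Integration.integral_add) simp_all
qed

lemma risk_nonneg: "0 \<le> (\<integral>z. \<phi> (snd z) (evl f (fst z)) \<partial>\<rho>)"
  by (intro Bochner_Integration.integral_nonneg) (auto intro: phi_nonneg dest: space_rhoD)

lemma excess_risk_nonneg: "0 \<le> excess_risk f"
  using fH_min[of f] risk_nonneg[of f] unfolding gen_err_eq_integral excess_risk_eq by simp

text \<open>Every f in the space has bounded loss, so all risks are finite and the extended-real
  claim reduces to the real number \<open>excess_risk f\<close>.\<close>

lemma gen_err_eq: "gen_err \<rho> \<phi> (evl f) = gen_err \<rho> \<phi> (evl fH) + ennreal (excess_risk f)"
  using excess_risk_nonneg[of f] risk_nonneg[of fH] unfolding gen_err_eq_integral
  by (simp add: excess_risk_eq flip: ennreal_plus)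

lemma excess_risk_le:
  assumes "dist_sq f \<le> R" "1 \<le> R"
  shows "excess_risk f \<le> 2 * \<kappa> * G * R"
  using bounded_expectation(2)[OF measurable_excess_loss abs_excess_loss_le[OF _ assms]]
  by (simp add: excess_risk_def)

lemma expectation_excess_loss_sq_le:
  assumes "dist_sq f \<le> R"
  shows "(\<integral>z. (excess_loss f z)\<^sup>2 \<partial>\<rho>) \<le> \<kappa>\<^sup>2 * R * (A * excess_risk f + 2 * noise)"
proof -
  have "(\<integral>z. (excess_loss f z)\<^sup>2 \<partial>\<rho>) \<le> (\<integral>z. \<kappa>\<^sup>2 * dist_sq f * (A * excess_loss f z + 2 * noise) \<partial>\<rho>)"
  proof (rule integral_mono)
    show "integrable \<rho> (\<lambda>z. (excess_loss f z)\<^sup>2)"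
    proof (rule bounded_expectation(1))
      show "\<bar>(excess_loss f z)\<^sup>2\<bar> \<le> (2 * \<kappa> * G * max 1 (dist_sq f))\<^sup>2" if "z \<in> space \<rho>" for z
        using power_mono[OF abs_excess_loss_le[OF that dist_sq_bound] abs_ge_zero, where n = 2] by simp
    qed measurable
  qed (auto intro: excess_loss_sq_le)
  also have "\<dots> = \<kappa>\<^sup>2 * dist_sq f * (A * excess_risk f + 2 * noise)"
    by (simp add: excess_risk_def prob_space)
  also have "\<dots> \<le> \<kappa>\<^sup>2 * R * (A * excess_risk f + 2 * noise)"
    using assms A_pos noise(1) excess_risk_nonneg[of f] by (intro mult_right_mono mult_left_mono) auto
  finally show ?thesis .
qed

section \<open>The gradient of the risk\<close>

text \<open>The gradient is the Riesz representer v of the functional sending u to the mean of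
  \<phi>'(y, f(x)) u(x), which is bounded by the growth of \<phi>' and the kernel bound. Testing
  with kernel sections gives \<open>risk_grad\<close>, testing with v itself gives
  \<open>grad_sq\<close>.\<close>

lemma risk_grad_repr:
  obtains v where "\<And>x. x \<in> X \<Longrightarrow> risk_grad f x = evl v x" "grad_sq f = (norm v)\<^sup>2"
proof -
  define l where "l u = (\<integral>z. \<phi>' (snd z) (evl f (fst z)) * evl u (fst z) \<partial>\<rho>)" for u
  define b where "b = G * (1 + norm (f - fH))"
  have b: "\<bar>\<phi>' (snd z) (evl f (fst z)) * evl u (fst z)\<bar> \<le> norm u * (b * \<kappa>)" if "z \<in> space \<rho>" for u z
  proof -
    have "\<bar>\<phi>' (snd z) (evl f (fst z)) * evl u (fst z)\<bar> \<le> b * (\<kappa> * norm u)"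
      unfolding abs_mult b_def using abs_phi'_le[OF space_rhoD[OF that], of f] abs_evl_le[OF space_rhoD(1)[OF that], of u] G_nonneg
      by (intro mult_mono) auto
    then show ?thesis by (simp add: mult_ac)
  qed
  have meas: "(\<lambda>z. \<phi>' (snd z) (evl f (fst z)) * evl u (fst z)) \<in> borel_measurable \<rho>" for u
    by (intro borel_measurable_times measurable_deriv_loss measurable_evl ident_sample)
  note int = bounded_expectation[OF meas b]
  have "bounded_linear l"
  proof (rule bounded_linear_intro)
    fix u v
    have "l (u + v) = (\<integral>z. \<phi>' (snd z) (evl f (fst z)) * evl u (fst z) + \<phi>' (snd z) (evl f (fst z)) * evl v (fst z) \<partial>\<rho>)"
      unfolding l_def
      by (intro Bochner_Integration.integral_cong) (auto simp: evl_inner inner_add_left algebra_simps dest!: space_rhoD(1))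
    then show "l (u + v) = l u + l v"
      unfolding l_def using int(1) by simp
  next
    fix c u
    have "l (c *\<^sub>R u) = (\<integral>z. c * (\<phi>' (snd z) (evl f (fst z)) * evl u (fst z)) \<partial>\<rho>)"
      unfolding l_def
      by (intro Bochner_Integration.integral_cong) (auto simp: evl_inner algebra_simps dest!: space_rhoD(1))
    then show "l (c *\<^sub>R u) = c *\<^sub>R l u"
      unfolding l_def by simp
  next
    show "norm (l u) \<le> norm u * (b * \<kappa>)" for u
      unfolding l_def using int(2) by simp
  qed
  then obtain v where v: "\<And>u. l u = inner v u" by (rule riesz_representation) blast
  have grad: "risk_grad f x = evl v x" if "x \<in> X" for x
  proof -
    have "evl (Kx x) (fst z) = K (fst z) x" if "z \<in> space \<rho>" for z
      using \<open>x \<in> X\<close> space_rhoD(1)[OF that] by (metis evl_inner inner_Kx inner_commute)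
    then have "risk_grad f x = l (Kx x)"
      unfolding risk_grad_def l_def by (intro Bochner_Integration.integral_cong) auto
    then show ?thesis using that by (simp add: v evl_inner)
  qed
  have "grad_sq f = l v"
    unfolding grad_sq_def l_def by (intro Bochner_Integration.integral_cong) (auto simp: grad dest: space_rhoD)
  with v grad show ?thesis by (intro that[of v]) (auto simp: power2_norm_eq_inner)
qed

lemma grad_sq_nonneg: "0 \<le> grad_sq f"
  by (rule risk_grad_repr[of f]) simp

lemma risk_grad_sq_le:
  assumes "x \<in> X"
  shows "(risk_grad f x)\<^sup>2 \<le> \<kappa>\<^sup>2 * grad_sq f"
proof -
  obtain v where v: "\<And>x. x \<in> X \<Longrightarrow> risk_grad f x = evl v x" "grad_sq f = (norm v)\<^sup>2"
    using risk_grad_repr by blast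
  have "\<bar>evl v x\<bar>\<^sup>2 \<le> (\<kappa> * norm v)\<^sup>2" by (intro power_mono abs_evl_le assms) simp
  then show ?thesis using assms by (simp add: v power_mult_distrib)
qed

text \<open>Inner product of the stochastic gradient at z with the gradient of the risk. It is not
  centred: its mean is \<open>grad_sq f\<close>.\<close>

definition grad_noise :: "'h \<Rightarrow> 'x \<times> real \<Rightarrow> real" where
  "grad_noise f z = \<phi>' (snd z) (evl f (fst z)) * risk_grad f (fst z)"

lemma measurable_grad_noise [measurable]: "grad_noise f \<in> borel_measurable \<rho>"
proof -
  obtain v where v: "\<And>x. x \<in> X \<Longrightarrow> risk_grad f x = evl v x" using risk_grad_repr by blast
  have "(\<lambda>z. \<phi>' (snd z) (evl f (fst z)) * evl v (fst z)) \<in> borel_measurable \<rho>"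
    by (intro borel_measurable_times measurable_deriv_loss measurable_evl ident_sample)
  also have "?this \<longleftrightarrow> ?thesis"
    by (intro measurable_cong) (simp add: grad_noise_def v space_rhoD)
  finally show ?thesis .
qed

lemma grad_noise_sq_le:
  assumes "z \<in> space \<rho>" "dist_sq f \<le> R" "1 \<le> R"
  shows "(grad_noise f z)\<^sup>2 \<le> 4 * G\<^sup>2 * R * \<kappa>\<^sup>2 * grad_sq f"
proof -
  have "(grad_noise f z)\<^sup>2 \<le> (4 * G\<^sup>2 * R) * (\<kappa>\<^sup>2 * grad_sq f)"
    unfolding grad_noise_def power_mult_distrib
    using assms by (intro mult_mono phi'_sq_le risk_grad_sq_le) (auto dest: space_rhoD)
  then show ?thesis by (simp add: mult_ac)
qed

text \<open>A self-improving bound: N = \<open>grad_sq f\<close> is the mean of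
  \<open>grad_noise f\<close>, whose square is at most Q N, so N \<le> sqrt (Q N) and hence N \<le>
  Q.\<close>

lemma grad_sq_le:
  assumes "dist_sq f \<le> R" "1 \<le> R"
  shows "grad_sq f \<le> 4 * G\<^sup>2 * R * \<kappa>\<^sup>2"
proof (cases "grad_sq f = 0")
  case True
  then show ?thesis using assms(2) by simp
next
  case False
  define Q where "Q = 4 * G\<^sup>2 * R * \<kappa>\<^sup>2"
  have "\<bar>grad_noise f z\<bar> \<le> sqrt (Q * grad_sq f)" if "z \<in> space \<rho>" for z
    using grad_noise_sq_le[OF that assms] by (intro real_le_rsqrt) (simp add: Q_def)
  from bounded_expectation(2)[OF measurable_grad_noise this]
  have "grad_sq f \<le> sqrt (Q * grad_sq f)"
    by (simp add: grad_sq_def grad_noise_def)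
  then have "(grad_sq f)\<^sup>2 \<le> (sqrt (Q * grad_sq f))\<^sup>2"
    using grad_sq_nonneg by (intro power_mono) auto
  also have "\<dots> = Q * grad_sq f"
    using grad_sq_nonneg[of f] assms(2) by (simp add: Q_def)
  finally show ?thesis
    using False grad_sq_nonneg[of f] by (simp add: Q_def power2_eq_square mult_le_cancel_right)
qed

lemma abs_grad_noise_le:
  assumes "z \<in> space \<rho>" "dist_sq f \<le> R" "1 \<le> R"
  shows "\<bar>grad_noise f z\<bar> \<le> 4 * G\<^sup>2 * R * \<kappa>\<^sup>2"
proof (rule power2_le_imp_le)
  have "(grad_noise f z)\<^sup>2 \<le> (4 * G\<^sup>2 * R * \<kappa>\<^sup>2) * grad_sq f"
    using grad_noise_sq_le[OF assms] by simp
  also have "\<dots> \<le> (4 * G\<^sup>2 * R * \<kappa>\<^sup>2) * (4 * G\<^sup>2 * R * \<kappa>\<^sup>2)"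
    using assms(3) by (intro mult_left_mono grad_sq_le assms(2,3)) auto
  finally show "\<bar>grad_noise f z\<bar>\<^sup>2 \<le> (4 * G\<^sup>2 * R * \<kappa>\<^sup>2)\<^sup>2" by (simp add: power2_eq_square)
qed (use assms(3) in simp)

lemma expectation_grad_noise: "expectation (grad_noise f) = grad_sq f"
  by (simp add: grad_noise_def[abs_def] grad_sq_def)

lemma expectation_grad_noise_sq_le:
  assumes "dist_sq f \<le> R" "1 \<le> R"
  shows "expectation (\<lambda>z. (grad_noise f z)\<^sup>2) \<le> 4 * G\<^sup>2 * R * \<kappa>\<^sup>2 * grad_sq f"
proof -
  have "\<bar>(grad_noise f z)\<^sup>2\<bar> \<le> 4 * G\<^sup>2 * R * \<kappa>\<^sup>2 * grad_sq f" if "z \<in> space \<rho>" for z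
    using grad_noise_sq_le[OF that assms] by simp
  from bounded_expectation(2)[OF _ this] show ?thesis by simp
qed

text \<open>The scalar descent inequality holds at each z with a shift of size at most |a|
  \<kappa>^2, so its remainder is bounded by a constant and the inequality can be
  integrated.\<close>

lemma excess_risk_descent:
  assumes "x \<in> X"
  shows "excess_risk (f - a *\<^sub>R Kx x) \<le>
    excess_risk f - a * risk_grad f x + L * (\<kappa>\<^sup>2) powr (1 + \<alpha>) * \<bar>a\<bar> powr (1 + \<alpha>)"
proof -
  define c where "c = L * (\<kappa>\<^sup>2) powr (1 + \<alpha>) * \<bar>a\<bar> powr (1 + \<alpha>)"
  define k where "k z = \<phi>' (snd z) (evl f (fst z)) * K (fst z) x" for z
  have symK: "K x (fst z) = K (fst z) x" "evl (Kx x) (fst z) = K (fst z) x" if "z \<in> space \<rho>" for z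
    using assms space_rhoD(1)[OF that] by (metis evl_inner inner_Kx inner_commute)+
  have kint: "integrable \<rho> k"
  proof (rule bounded_expectation(1))
    have "(\<lambda>z. \<phi>' (snd z) (evl f (fst z)) * evl (Kx x) (fst z)) \<in> borel_measurable \<rho>"
      by (intro borel_measurable_times measurable_deriv_loss measurable_evl ident_sample)
    also have "?this \<longleftrightarrow> k \<in> borel_measurable \<rho>"
      by (intro measurable_cong) (simp add: k_def symK)
    finally show "k \<in> borel_measurable \<rho>" .
    show "\<bar>k z\<bar> \<le> (G * (1 + norm (f - fH))) * \<kappa>\<^sup>2" if "z \<in> space \<rho>" for z
      unfolding k_def abs_mult using G_nonneg
      by (intro mult_mono abs_phi'_le abs_K_le assms space_rhoD[OF that]) auto
  qed
  have "excess_loss (f - a *\<^sub>R Kx x) z \<le> excess_loss f z - a * k z + c" if z: "z \<in> space \<rho>" for z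
  proof -
    let ?s = "evl f (fst z)" and ?s' = "evl (f - a *\<^sub>R Kx x) (fst z)"
    have s': "?s' - ?s = - (a * K (fst z) x)"
      using space_rhoD(1)[OF z] symK(2)[OF z] by (simp add: evl_inner inner_diff_left)
    have "\<bar>?s' - ?s\<bar> powr (1 + \<alpha>) \<le> (\<bar>a\<bar> * \<kappa>\<^sup>2) powr (1 + \<alpha>)"
      unfolding s' using alpha space_rhoD(1)[OF z] assms
      by (intro powr_mono2) (auto simp: abs_mult intro!: mult_left_mono abs_K_le)
    also have "\<dots> = (\<kappa>\<^sup>2) powr (1 + \<alpha>) * \<bar>a\<bar> powr (1 + \<alpha>)"
      by (simp add: powr_mult mult.commute)
    finally have "L * \<bar>?s' - ?s\<bar> powr (1 + \<alpha>) \<le> c"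
      using L_pos by (simp add: c_def mult.assoc mult_left_mono)
    moreover have "\<phi> (snd z) ?s' \<le> \<phi> (snd z) ?s + \<phi>' (snd z) ?s * (?s' - ?s) + L * \<bar>?s' - ?s\<bar> powr (1 + \<alpha>)"
      using alpha L_pos space_rhoD(2)[OF z] by (intro hoelder_descent phi_deriv hoelder) auto
    ultimately show ?thesis unfolding excess_loss_def k_def s' by (simp add: algebra_simps)
  qed
  then have "excess_risk (f - a *\<^sub>R Kx x) \<le> (\<integral>z. excess_loss f z - a * k z + c \<partial>\<rho>)"
    unfolding excess_risk_def using kint by (intro integral_mono) auto
  also have "\<dots> = excess_risk f - a * risk_grad f x + c"
    using kint by (simp add: excess_risk_def risk_grad_def k_def[abs_def] prob_space)
  finally show ?thesis by (simp add: c_def)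
qed

subsection \<open>One step of the iteration\<close>

text \<open>What remains in front of the excess loss d once convexity has contributed -2 \<eta> d
  and the squared step at most \<eta>^2 \<kappa>^2 (A d + noise).\<close>

definition step_coeff :: "nat \<Rightarrow> real" where
  "step_coeff t = 2 * \<eta> t - (\<eta> t)\<^sup>2 * \<kappa>\<^sup>2 * A"

lemma step_coeff_bounds:
  assumes "1 \<le> t"
  shows "\<eta> t \<le> step_coeff t" "step_coeff t \<le> 2 * \<eta> t"
proof -
  have "(\<eta> t)\<^sup>2 * \<kappa>\<^sup>2 * A = \<eta> t * (\<eta> t * (A * \<kappa>\<^sup>2))" by (simp add: power2_eq_square)
  also have "\<dots> \<le> \<eta> t * 1"
    using eta_le[OF assms] eta_pos[OF assms] by (intro mult_left_mono) auto
  finally show "\<eta> t \<le> step_coeff t" by (simp add: step_coeff_def)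
  show "step_coeff t \<le> 2 * \<eta> t" using A_pos by (simp add: step_coeff_def)
qed

lemma dist_sq_step:
  assumes z: "h (Suc n) \<in> space \<rho>"
  shows "dist_sq (iter h (Suc n)) \<le> dist_sq (iter h n)
    - step_coeff (Suc n) * excess_loss (iter h n) (h (Suc n)) + \<kappa>\<^sup>2 * noise * (\<eta> (Suc n))\<^sup>2"
proof -
  define f where "f = iter h n"
  define x where "x = fst (h (Suc n))"
  define d where "d = excess_loss f (h (Suc n))"
  define t where "t = Suc n"
  have x: "x \<in> X" using z space_rhoD by (simp add: x_def)
  have g: "(grad_weight h n)\<^sup>2 \<le> A * d + noise"
    using phi'_sq_le_excess_loss[OF z, of f] by (simp add: grad_weight_def f_def d_def)
  have "dist_sq (iter h (Suc n)) = dist_sq f - 2 * \<eta> t * (grad_weight h n * (evl f x - evl fH x))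
      + (\<eta> t)\<^sup>2 * (grad_weight h n)\<^sup>2 * K x x"
    using dist_sq_iter_Suc[of h n] x by (simp add: f_def x_def t_def)
  also have "\<dots> \<le> dist_sq f - 2 * \<eta> t * d + (\<eta> t)\<^sup>2 * (A * d + noise) * \<kappa>\<^sup>2"
  proof (intro add_mono diff_left_mono mult_left_mono)
    \<comment> \<open>Here d may be negative, but A d + noise dominates a square and is therefore
      nonnegative, which permits replacing K x x by \<kappa>^2.\<close>
    show "(\<eta> t)\<^sup>2 * (grad_weight h n)\<^sup>2 * K x x \<le> (\<eta> t)\<^sup>2 * (A * d + noise) * \<kappa>\<^sup>2"
      using g K_diag[OF x] K_diag_nonneg[OF x] order_trans[OF zero_le_power2 g]
      by (intro mult_mono mult_nonneg_nonneg) auto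
    show "d \<le> grad_weight h n * (evl f x - evl fH x)"
      using excess_loss_tangent(1)[OF z, of f] by (simp add: d_def grad_weight_def f_def x_def)
    show "0 \<le> 2 * \<eta> t" using eta_pos[of t] by (simp add: t_def)
  qed
  also have "\<dots> = dist_sq f - step_coeff t * d + \<kappa>\<^sup>2 * noise * (\<eta> t)\<^sup>2"
    by (simp add: step_coeff_def algebra_simps)
  finally show ?thesis by (simp add: f_def d_def t_def)
qed

text \<open>The last factor comes from |g|^(1 + \<alpha>) \<le> 1 + g^2 and g^2 \<le> 4 G^2 R with R
  \<ge> 1, where g is the derivative of the loss at the current iterate.\<close>

definition descent_const :: real where
  "descent_const = L * (\<kappa>\<^sup>2) powr (1 + \<alpha>) * (1 + 4 * G\<^sup>2)"

lemma descent_const_nonneg: "0 \<le> descent_const"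
  using L_pos by (simp add: descent_const_def)

lemma excess_risk_step:
  assumes z: "h (Suc n) \<in> space \<rho>" and R: "dist_sq (iter h n) \<le> R" "1 \<le> R"
  shows "excess_risk (iter h (Suc n)) \<le> excess_risk (iter h n)
    - \<eta> (Suc n) * grad_noise (iter h n) (h (Suc n)) + descent_const * R * \<eta> (Suc n) powr (1 + \<alpha>)"
proof -
  define g where "g = grad_weight h n"
  have \<eta>: "0 < \<eta> (Suc n)" by (rule eta_pos) simp
  have "g\<^sup>2 \<le> 4 * G\<^sup>2 * R"
    unfolding g_def grad_weight_def using phi'_sq_le R space_rhoD[OF z] by blast
  moreover have "\<bar>g\<bar> powr (1 + \<alpha>) \<le> 1 + \<bar>g\<bar>\<^sup>2"
    using powr_le_quadratic[of "\<bar>g\<bar>" 1 \<alpha>] alpha by simp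
  ultimately have g: "\<bar>g\<bar> powr (1 + \<alpha>) \<le> (1 + 4 * G\<^sup>2) * R"
    using R(2) by (simp add: algebra_simps)
  have "excess_risk (iter h (Suc n)) \<le> excess_risk (iter h n) - (\<eta> (Suc n) * g) * risk_grad (iter h n) (fst (h (Suc n)))
      + L * (\<kappa>\<^sup>2) powr (1 + \<alpha>) * \<bar>\<eta> (Suc n) * g\<bar> powr (1 + \<alpha>)"
    unfolding iter_Suc g_def[symmetric] by (rule excess_risk_descent[OF space_rhoD(1)[OF z]])
  also have "\<bar>\<eta> (Suc n) * g\<bar> powr (1 + \<alpha>) = \<eta> (Suc n) powr (1 + \<alpha>) * \<bar>g\<bar> powr (1 + \<alpha>)"
    using \<eta> by (simp add: abs_mult powr_mult)
  also have "L * (\<kappa>\<^sup>2) powr (1 + \<alpha>) * (\<eta> (Suc n) powr (1 + \<alpha>) * \<bar>g\<bar> powr (1 + \<alpha>)) \<le>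
      L * (\<kappa>\<^sup>2) powr (1 + \<alpha>) * (\<eta> (Suc n) powr (1 + \<alpha>) * ((1 + 4 * G\<^sup>2) * R))"
    using g L_pos by (intro mult_left_mono) auto
  also have "\<dots> = descent_const * R * \<eta> (Suc n) powr (1 + \<alpha>)"
    by (simp add: descent_const_def mult_ac)
  finally show ?thesis
    by (simp add: g_def grad_weight_def grad_noise_def mult.assoc)
qed

subsection \<open>The iterates stay in a ball of logarithmic radius\<close>

abbreviation samples :: "nat \<Rightarrow> (nat \<Rightarrow> 'x \<times> real) measure" where
  "samples n \<equiv> Pi\<^sub>M {1..n} (\<lambda>_. \<rho>)"

definition S2 :: real where
  "S2 = (\<Sum>t. (\<eta> (Suc t))\<^sup>2)"

lemma sum_eta_sq_le: "(\<Sum>t = 1..n. (\<eta> t)\<^sup>2) \<le> S2"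
proof -
  have "(\<Sum>t = 1..n. (\<eta> t)\<^sup>2) = (\<Sum>t<n. (\<eta> (Suc t))\<^sup>2)"
    by (rule sum.reindex_bij_witness[of _ Suc "\<lambda>t. t - 1"]) auto
  also have "\<dots> \<le> S2" unfolding S2_def by (rule sum_le_suminf[OF eta_sq]) auto
  finally show ?thesis .
qed

lemma S2_nonneg: "0 \<le> S2"
  using sum_eta_sq_le[of 0] by simp

lemma eta_antimono:
  assumes "1 \<le> s" "s \<le> t"
  shows "\<eta> t \<le> \<eta> s"
  using assms(2)
proof (induction t rule: dec_induct)
  case (step n)
  then show ?case using eta_mono[of n] assms(1) by simp
qed simp

text \<open>For \<eta> \<le> eps / l the multiplier a of a norm increment is at most 4 eps / R. The
  first bound makes a (2 \<kappa> G R) at most 1/2, as the moment lemma requires; the second keeps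
  the risk part of the compensator below a quarter of the drift. The summand 1 covers \<kappa> =
  0.\<close>

definition eps :: real where
  "eps = 1 / (16 * (\<kappa> * G + \<kappa>\<^sup>2 * A + 1))"

lemma eps_pos: "0 < eps" and eps_bounds: "eps * (\<kappa> * G) \<le> 1 / 16" "eps * (\<kappa>\<^sup>2 * A) \<le> 1 / 16"
proof -
  define q where "q = \<kappa> * G + \<kappa>\<^sup>2 * A + 1"
  have q: "\<kappa> * G \<le> q" "\<kappa>\<^sup>2 * A \<le> q" "0 < q"
    using kappa_nonneg G_nonneg A_pos by (auto simp: q_def add_nonneg_pos)
  have eps: "eps = 1 / 16 * (1 / q)" by (simp add: eps_def q_def)
  show "0 < eps" using q by (simp add: eps)
  show "eps * (\<kappa> * G) \<le> 1 / 16" "eps * (\<kappa>\<^sup>2 * A) \<le> 1 / 16"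
    using q by (simp_all add: eps field_simps)
qed

text \<open>Steps with \<open>\<eta> t > eps / l\<close> are too large for the exponential moment bound; since then
  \<open>\<eta> t \<le> (\<eta> t)\<^sup>2 * l / eps\<close>, square summability bounds their total contribution by \<open>O(l)\<close>.\<close>
definition small :: "real \<Rightarrow> nat \<Rightarrow> bool" where
  "small l t \<longleftrightarrow> \<eta> t \<le> eps / l"

text \<open>The norm of \<open>fH\<close> is the initial distance, as the first iterate is 0. The
  factor 17 is 16 from the compensator plus 1 from the squared steps, and 2 B / eps pays for the
  large steps. Doubling in \<open>radius\<close> makes room for the martingale: its sum is at most l
  and is rescaled by R / (2 l), which costs R / 2.\<close>

definition radius_const :: real where
  "radius_const = (norm fH)\<^sup>2 + (17 * \<kappa>\<^sup>2 * noise + 2 * B / eps) * S2 + 1"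

definition radius :: "real \<Rightarrow> real" where
  "radius l = 2 * radius_const * l"

lemma radius_const_ge_1: "1 \<le> radius_const"
  using noise(1) B_nonneg eps_pos S2_nonneg by (simp add: radius_const_def)

lemma radius_ge_1: "1 \<le> l \<Longrightarrow> 1 \<le> radius l"
proof -
  assume "1 \<le> l"
  then have "1 * 1 \<le> (2 * radius_const) * l" using radius_const_ge_1 by (intro mult_mono) auto
  then show ?thesis by (simp add: radius_def)
qed

lemma not_small_le:
  assumes "\<not> small l t" "1 \<le> l" "1 \<le> t"
  shows "\<eta> t \<le> l / eps * (\<eta> t)\<^sup>2"
proof -
  have "1 \<le> l / eps * \<eta> t" using assms eps_pos by (simp add: small_def field_simps)
  then have "1 * \<eta> t \<le> (l / eps * \<eta> t) * \<eta> t" using eta_pos[OF assms(3)] by (intro mult_right_mono) auto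
  then show ?thesis by (simp add: power2_eq_square)
qed

text \<open>The subtracted term is the compensator of the moment lemma. The condition looks at the
  current iterate only, not at the whole past, and is determined by the samples before t; no
  stopping time is needed, since \<open>norm_bound\<close> shows that on the good event the ball is
  never left.\<close>

definition norm_increment :: "real \<Rightarrow> nat \<Rightarrow> (nat \<Rightarrow> 'x \<times> real) \<Rightarrow> real" where
  "norm_increment l t h = (let f = iter h (t - 1); R = radius l; a = 2 * l / R * step_coeff t in
    if small l t \<and> dist_sq f \<le> R
    then a * (excess_risk f - excess_loss f (h t)) - a\<^sup>2 * (\<kappa>\<^sup>2 * R * (A * excess_risk f + 2 * noise))
    else 0)"

lemma iter_upd: "n < i \<Longrightarrow> iter (h(i := x)) n = iter h n"
  by (rule iter_cong) auto

lemma norm_increment_upd: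
  assumes "1 \<le> t" "t < i"
  shows "norm_increment l t (h(i := x)) = norm_increment l t h"
proof -
  have "(h(i := x)) t = h t" "iter (h(i := x)) (t - 1) = iter h (t - 1)"
    using assms by (auto intro: iter_upd)
  then show ?thesis unfolding norm_increment_def by (simp only:)
qed

lemma norm_increment_measurable:
  assumes "1 \<le> t" "t \<le> n"
  shows "norm_increment l t \<in> borel_measurable (samples n)"
proof -
  have h: "(\<lambda>h. h i) \<in> samples n \<rightarrow>\<^sub>M \<rho>" if "1 \<le> i" "i \<le> t" for i
    using that assms by (intro measurable_component_singleton) auto
  have h': "(\<lambda>h. h i) \<in> samples n \<rightarrow>\<^sub>M \<rho>" if "1 \<le> i" "i \<le> t - 1" for i
    using that by (intro h) auto
  note [measurable] = measurable_dist_sq_iter[OF h'] measurable_excess_risk_iter[OF h']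
    measurable_excess_loss_iter[OF h' h[OF assms(1) order_refl]]
  show ?thesis unfolding norm_increment_def Let_def by measurable
qed

lemma step_coeff_small:
  assumes "small l t" "1 \<le> l" "1 \<le> t"
  shows "l * step_coeff t \<le> 2 * eps" "0 \<le> step_coeff t"
proof -
  have "l * step_coeff t \<le> l * (2 * (eps / l))"
    using step_coeff_bounds[OF assms(3)] assms by (intro mult_left_mono) (auto simp: small_def)
  then show "l * step_coeff t \<le> 2 * eps" using assms by simp
  show "0 \<le> step_coeff t" using step_coeff_bounds(1)[OF assms(3)] eta_pos[OF assms(3)] by simp
qed

lemma norm_increment_moment:
  assumes "1 \<le> l" "1 \<le> t"
  shows "(\<integral>\<^sup>+x. ennreal (exp (norm_increment l t (h(t := x)))) \<partial>\<rho>) \<le> 1"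
proof -
  define f where "f = iter h (t - 1)"
  define R where "R = radius l"
  define a where "a = 2 * l / R * step_coeff t"
  have R: "1 \<le> R" using radius_ge_1[OF assms(1)] by (simp add: R_def)
  have iter_f: "iter (h(t := x)) (t - 1) = f" for x
    using assms(2) by (simp add: f_def iter_upd)
  show ?thesis
  proof (cases "small l t \<and> dist_sq f \<le> R")
    case True
    then have c: "l * step_coeff t \<le> 2 * eps" "0 \<le> step_coeff t"
      using step_coeff_small assms by auto
    have a: "0 \<le> a" "a \<le> 4 * eps / R"
      using c assms R by (auto simp: a_def field_simps)
    have "\<bar>a\<bar> * (2 * \<kappa> * G * R) \<le> 4 * eps / R * (2 * \<kappa> * G * R)"
      using a kappa_nonneg G_nonneg R by (intro mult_right_mono) auto
    also have "\<dots> = 8 * (eps * (\<kappa> * G))" using R by simp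
    also have "\<dots> \<le> 1 / 2" using eps_bounds(1) by simp
    finally have small_a: "\<bar>a\<bar> * (2 * \<kappa> * G * R) \<le> 1 / 2" .
    have "(\<integral>\<^sup>+x. ennreal (exp (a * (expectation (excess_loss f) - excess_loss f x)
        - a\<^sup>2 * (\<kappa>\<^sup>2 * R * (A * excess_risk f + 2 * noise)))) \<partial>\<rho>) \<le> 1"
    proof (rule exp_moment_le_1)
      show "\<bar>excess_loss f x\<bar> \<le> 2 * \<kappa> * G * R" if "x \<in> space \<rho>" for x
        using abs_excess_loss_le[OF that] True R by blast
      show "a\<^sup>2 * expectation (\<lambda>x. (excess_loss f x)\<^sup>2) \<le> a\<^sup>2 * (\<kappa>\<^sup>2 * R * (A * excess_risk f + 2 * noise))"
        using True by (intro mult_left_mono expectation_excess_loss_sq_le) auto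
    qed (use small_a in simp_all)
    then show ?thesis
      using True unfolding norm_increment_def Let_def iter_f
      by (simp add: excess_risk_def[abs_def] R_def a_def)
  next
    case False
    then show ?thesis
      unfolding norm_increment_def Let_def iter_f by (auto simp: R_def emeasure_space_1)
  qed
qed

text \<open>Rescaled by R / (2 l), a small-step increment is c (e - d) - 2 l c^2 \<kappa>^2 (A e + 2
  noise). The part with e is at most c e / 4, so c e / 2 can be kept on the left. At a large step
  the excess loss is at least -B and \<eta> \<le> \<eta>^2 l / eps.\<close>

lemma step_decrease_le:
  assumes "1 \<le> l" "1 \<le> t" and z: "h t \<in> space \<rho>" and R: "dist_sq (iter h (t - 1)) \<le> radius l"
  shows "(if small l t then step_coeff t * excess_risk (iter h (t - 1)) / 2 else 0)
      - step_coeff t * excess_loss (iter h (t - 1)) (h t)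
    \<le> radius l / (2 * l) * norm_increment l t h + (16 * \<kappa>\<^sup>2 * noise + 2 * B / eps) * l * (\<eta> t)\<^sup>2"
proof (cases "small l t")
  case True
  define f where "f = iter h (t - 1)"
  define c where "c = step_coeff t"
  define e where "e = excess_risk f"
  define d where "d = excess_loss f (h t)"
  define a where "a = 2 * l / radius l"
  have a: "0 < a" "radius l / (2 * l) = 1 / a" using radius_ge_1[OF assms(1)] assms(1) by (auto simp: a_def)
  have aR: "a * radius l = 2 * l" using radius_ge_1[OF assms(1)] by (simp add: a_def)
  have c: "0 \<le> c" "l * c \<le> 2 * eps" "c \<le> 2 * \<eta> t"
    using step_coeff_small[OF True assms(1,2)] step_coeff_bounds(2)[OF assms(2)] by (auto simp: c_def)
  have e: "0 \<le> e" by (simp add: e_def excess_risk_nonneg)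
  have "norm_increment l t h = (a * c) * (e - d) - (a * c)\<^sup>2 * (\<kappa>\<^sup>2 * radius l * (A * e + 2 * noise))"
    using True R unfolding norm_increment_def Let_def by (simp add: a_def c_def e_def d_def f_def)
  also have "\<dots> = a * (c * (e - d) - c\<^sup>2 * (a * radius l) * \<kappa>\<^sup>2 * (A * e + 2 * noise))"
    by (simp add: algebra_simps power2_eq_square)
  finally have inc: "radius l / (2 * l) * norm_increment l t h =
      c * (e - d) - c\<^sup>2 * (2 * l) * \<kappa>\<^sup>2 * (A * e + 2 * noise)"
    unfolding a(2) aR using a(1) by simp
  have "c\<^sup>2 * (2 * l) * \<kappa>\<^sup>2 * (A * e) = 2 * (l * c) * (\<kappa>\<^sup>2 * A) * (c * e)"
    by (simp add: power2_eq_square)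
  also have "\<dots> \<le> 2 * (2 * eps) * (\<kappa>\<^sup>2 * A) * (c * e)"
    using c e A_pos by (intro mult_right_mono mult_left_mono) auto
  also have "\<dots> = 4 * (eps * (\<kappa>\<^sup>2 * A)) * (c * e)" by simp
  also have "\<dots> \<le> 4 * (1 / 16) * (c * e)"
    using c e eps_bounds(2) by (intro mult_right_mono mult_left_mono) auto
  finally have 1: "c\<^sup>2 * (2 * l) * \<kappa>\<^sup>2 * (A * e) \<le> c * e / 4" by simp
  have "c\<^sup>2 \<le> (2 * \<eta> t)\<^sup>2" using c by (intro power_mono) auto
  then have "c\<^sup>2 * (4 * l * \<kappa>\<^sup>2 * noise) \<le> (2 * \<eta> t)\<^sup>2 * (4 * l * \<kappa>\<^sup>2 * noise)"
    using assms(1) noise(1) by (intro mult_right_mono) auto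
  then have 2: "c\<^sup>2 * (2 * l) * \<kappa>\<^sup>2 * (2 * noise) \<le> 16 * \<kappa>\<^sup>2 * noise * l * (\<eta> t)\<^sup>2"
    by (simp add: power_mult_distrib mult_ac)
  have "0 \<le> 2 * B / eps * l * (\<eta> t)\<^sup>2"
    using assms(1) B_nonneg eps_pos by simp
  moreover have "0 \<le> c * e" using c e by simp
  ultimately have "c * e / 2 - c * d \<le> radius l / (2 * l) * norm_increment l t h
      + (16 * \<kappa>\<^sup>2 * noise * l * (\<eta> t)\<^sup>2 + 2 * B / eps * l * (\<eta> t)\<^sup>2)"
    using 1 2 unfolding inc distrib_left[of _ "A * e"] right_diff_distrib by linarith
  then show ?thesis using True by (simp add: c_def d_def e_def f_def algebra_simps)
next
  case False
  have c: "0 \<le> step_coeff t" "step_coeff t \<le> 2 * \<eta> t"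
    using step_coeff_bounds[OF assms(2)] eta_pos[OF assms(2)] by auto
  have "- (step_coeff t * excess_loss (iter h (t - 1)) (h t)) \<le> step_coeff t * B"
    using mult_left_mono[OF excess_loss_ge[OF z, of "iter h (t - 1)"] c(1)] by simp
  also have "\<dots> \<le> 2 * \<eta> t * B" using c B_nonneg by (intro mult_right_mono) auto
  also have "\<dots> \<le> 2 * (l / eps * (\<eta> t)\<^sup>2) * B"
    using not_small_le[OF False assms(1,2)] B_nonneg by (intro mult_right_mono) auto
  also have "\<dots> \<le> (16 * \<kappa>\<^sup>2 * noise + 2 * B / eps) * l * (\<eta> t)\<^sup>2"
    using noise(1) assms(1) by (simp add: algebra_simps)
  finally show ?thesis using False by (simp add: norm_increment_def)
qed

lemma dist_sq_telescope:
  assumes "\<And>t. 1 \<le> t \<Longrightarrow> t \<le> n \<Longrightarrow> h t \<in> space \<rho>"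
  shows "dist_sq (iter h n) \<le> (norm fH)\<^sup>2
    - (\<Sum>t = 1..n. step_coeff t * excess_loss (iter h (t - 1)) (h t)) + \<kappa>\<^sup>2 * noise * (\<Sum>t = 1..n. (\<eta> t)\<^sup>2)"
  using assms
proof (induction n)
  case 0
  show ?case by (simp add: dist_sq_def)
next
  case (Suc n)
  have "dist_sq (iter h n) \<le> (norm fH)\<^sup>2
    - (\<Sum>t = 1..n. step_coeff t * excess_loss (iter h (t - 1)) (h t)) + \<kappa>\<^sup>2 * noise * (\<Sum>t = 1..n. (\<eta> t)\<^sup>2)"
    by (rule Suc.IH) (use Suc.prems in auto)
  then show ?case
    using dist_sq_step[of h n] Suc.prems[of "Suc n"] by (simp add: algebra_simps del: ogd.simps)
qed

text \<open>Strong induction along one path: the iterates before n lie in the ball, so the one-step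
  inequality applies to every t \<le> n, and summing it puts iterate n into the ball. Keeping the
  risk sum on the left gives the weighted risk bound for free; its terms are nonnegative, so each
  hypothesis contains the ball condition.\<close>

lemma norm_bound:
  assumes l: "1 \<le> l"
    and h: "\<And>t. 1 \<le> t \<Longrightarrow> t \<le> T \<Longrightarrow> h t \<in> space \<rho>"
    and good: "\<And>n. 1 \<le> n \<Longrightarrow> n \<le> T \<Longrightarrow> (\<Sum>t = 1..n. norm_increment l t h) \<le> l"
    and "n \<le> T"
  shows "dist_sq (iter h n)
    + (\<Sum>t = 1..n. if small l t then step_coeff t * excess_risk (iter h (t - 1)) / 2 else 0) \<le> radius l"
  using \<open>n \<le> T\<close>
proof (induction n rule: less_induct)
  case (less n)
  let ?e = "\<lambda>t. if small l t then step_coeff t * excess_risk (iter h (t - 1)) / 2 else 0"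
  define q where "q = 16 * \<kappa>\<^sup>2 * noise + 2 * B / eps"
  have q: "0 \<le> q" using noise(1) B_nonneg eps_pos by (simp add: q_def)
  have e0: "0 \<le> ?e t" if "1 \<le> t" for t
    using step_coeff_small(2)[OF _ l that] excess_risk_nonneg by simp
  have R: "dist_sq (iter h (t - 1)) \<le> radius l" if "1 \<le> t" "t \<le> n" for t
  proof -
    have "0 \<le> (\<Sum>t = 1..t - 1. ?e t)" by (intro sum_nonneg) (use e0 in auto)
    moreover have "t - 1 < n" "t - 1 \<le> T" using that less.prems by auto
    ultimately show ?thesis using less.IH[of "t - 1"] by linarith
  qed
  have "(\<Sum>t = 1..n. ?e t - step_coeff t * excess_loss (iter h (t - 1)) (h t)) \<le>
      (\<Sum>t = 1..n. radius l / (2 * l) * norm_increment l t h + q * l * (\<eta> t)\<^sup>2)"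
    unfolding q_def using less.prems R by (intro sum_mono step_decrease_le l h) auto
  also have "\<dots> = radius l / (2 * l) * (\<Sum>t = 1..n. norm_increment l t h) + q * l * (\<Sum>t = 1..n. (\<eta> t)\<^sup>2)"
    by (simp add: sum.distrib sum_distrib_left)
  also have "\<dots> \<le> radius l / (2 * l) * l + q * l * S2"
  proof (intro add_mono mult_left_mono sum_eta_sq_le)
    show "(\<Sum>t = 1..n. norm_increment l t h) \<le> l"
      using good[of n] less.prems l by (cases "n = 0") auto
  qed (use radius_ge_1[OF l] l q in auto)
  also have "radius l / (2 * l) * l = radius_const * l" using l by (simp add: radius_def)
  finally have sum_le: "(\<Sum>t = 1..n. ?e t) - (\<Sum>t = 1..n. step_coeff t * excess_loss (iter h (t - 1)) (h t))
      \<le> radius_const * l + q * l * S2"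
    by (simp only: sum_subtractf)
  have "dist_sq (iter h n) \<le> (norm fH)\<^sup>2
      - (\<Sum>t = 1..n. step_coeff t * excess_loss (iter h (t - 1)) (h t)) + \<kappa>\<^sup>2 * noise * (\<Sum>t = 1..n. (\<eta> t)\<^sup>2)"
    using less.prems by (intro dist_sq_telescope h) auto
  moreover have "\<kappa>\<^sup>2 * noise * (\<Sum>t = 1..n. (\<eta> t)\<^sup>2) \<le> \<kappa>\<^sup>2 * noise * S2"
    using noise(1) by (intro mult_left_mono sum_eta_sq_le) auto
  moreover have "(norm fH)\<^sup>2 + \<kappa>\<^sup>2 * noise * S2 \<le> ((norm fH)\<^sup>2 + \<kappa>\<^sup>2 * noise * S2) * l"
    using mult_left_mono[OF l, of "(norm fH)\<^sup>2 + \<kappa>\<^sup>2 * noise * S2"] noise(1) S2_nonneg by simp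
  moreover have "((norm fH)\<^sup>2 + \<kappa>\<^sup>2 * noise * S2) * l + q * l * S2 \<le> radius_const * l"
  proof -
    have "((norm fH)\<^sup>2 + \<kappa>\<^sup>2 * noise * S2) * l + q * l * S2 = (radius_const - 1) * l"
      by (simp add: radius_const_def q_def algebra_simps)
    also have "\<dots> \<le> radius_const * l" using l by (intro mult_right_mono) auto
    finally show ?thesis .
  qed
  ultimately show ?case
    using sum_le by (simp add: radius_def)
qed

subsection \<open>The last iterate\<close>

text \<open>With Q = 4 G^2 \<kappa>^2 R bounding both |\<open>grad_noise\<close>| and its second
  moment divided by \<open>grad_sq\<close>, the multiplier satisfies a Q \<le> 1/2, because \<eta> t
  \<le> \<eta> \<tau> for t \<ge> \<tau>. Normalising by \<eta> \<tau> makes the rescaled tail level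
  of order R l \<eta> \<tau>; the summand 1 avoids a zero denominator.\<close>

definition grad_increment :: "real \<Rightarrow> nat \<Rightarrow> nat \<Rightarrow> (nat \<Rightarrow> 'x \<times> real) \<Rightarrow> real" where
  "grad_increment l \<tau> t h = (let f = iter h (t - 1); R = radius l;
      a = \<eta> t / (2 * (4 * G\<^sup>2 * \<kappa>\<^sup>2 + 1) * R * \<eta> \<tau>) in
    if \<tau> \<le> t \<and> dist_sq f \<le> R
    then a * (grad_sq f - grad_noise f (h t)) - a\<^sup>2 * (4 * G\<^sup>2 * R * \<kappa>\<^sup>2 * grad_sq f)
    else 0)"

lemma grad_increment_upd:
  assumes "1 \<le> t" "t < i"
  shows "grad_increment l \<tau> t (h(i := x)) = grad_increment l \<tau> t h"
proof -
  have "(h(i := x)) t = h t" "iter (h(i := x)) (t - 1) = iter h (t - 1)"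
    using assms by (auto intro: iter_upd)
  then show ?thesis unfolding grad_increment_def by (simp only:)
qed

lemma grad_increment_measurable:
  assumes "1 \<le> t" "t \<le> n"
  shows "grad_increment l \<tau> t \<in> borel_measurable (samples n)"
proof -
  have h: "(\<lambda>h. h i) \<in> samples n \<rightarrow>\<^sub>M \<rho>" if "1 \<le> i" "i \<le> t" for i
    using that assms by (intro measurable_component_singleton) auto
  have h': "(\<lambda>h. h i) \<in> samples n \<rightarrow>\<^sub>M \<rho>" if "1 \<le> i" "i \<le> t - 1" for i
    using that by (intro h) auto
  note ht = h[OF assms(1) order_refl]
  note [measurable] = measurable_dist_sq_iter[OF h'] measurable_grad_sq_iter[OF h']
    measurable_risk_grad_iter[OF h' ht] measurable_loss(2)[OF ht measurable_evl_iter[OF h' ht]]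
  show ?thesis unfolding grad_increment_def grad_noise_def Let_def by measurable
qed

lemma grad_step_size:
  assumes "1 \<le> R" "1 \<le> \<tau>" "\<tau> \<le> t"
  defines "a \<equiv> \<eta> t / (2 * (4 * G\<^sup>2 * \<kappa>\<^sup>2 + 1) * R * \<eta> \<tau>)"
  shows "0 \<le> a" "a * (4 * G\<^sup>2 * R * \<kappa>\<^sup>2) \<le> 1 / 2"
proof -
  have \<eta>: "0 < \<eta> \<tau>" "0 < \<eta> t" "\<eta> t \<le> \<eta> \<tau>"
    using eta_pos[of \<tau>] eta_pos[of t] eta_antimono[of \<tau> t] assms by auto
  define q where "q = 4 * G\<^sup>2 * \<kappa>\<^sup>2"
  have q: "0 \<le> q" by (simp add: q_def)
  show "0 \<le> a" using \<eta> q assms(1) unfolding a_def q_def[symmetric] by simp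
  have cancel: "x / (2 * p * R * y) * (q * R) = x / y * (q / p) / 2" if "p \<noteq> 0" "y \<noteq> 0" for x y p
    using that assms(1) by (simp add: field_simps)
  have "4 * G\<^sup>2 * R * \<kappa>\<^sup>2 = q * R" by (simp add: q_def)
  moreover have "\<eta> t / (2 * (q + 1) * R * \<eta> \<tau>) * (q * R) = \<eta> t / \<eta> \<tau> * (q / (q + 1)) / 2"
    using q \<eta> by (intro cancel) auto
  ultimately have "a * (4 * G\<^sup>2 * R * \<kappa>\<^sup>2) = \<eta> t / \<eta> \<tau> * (q / (q + 1)) / 2"
    unfolding a_def q_def[symmetric] by (simp only:)
  also have "\<dots> \<le> 1 * 1 / 2"
    using \<eta> q by (intro divide_right_mono mult_mono) auto
  finally show "a * (4 * G\<^sup>2 * R * \<kappa>\<^sup>2) \<le> 1 / 2" by simp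
qed

lemma grad_increment_moment:
  assumes "1 \<le> l" "1 \<le> \<tau>" "1 \<le> t"
  shows "(\<integral>\<^sup>+x. ennreal (exp (grad_increment l \<tau> t (h(t := x)))) \<partial>\<rho>) \<le> 1"
proof -
  define f where "f = iter h (t - 1)"
  define R where "R = radius l"
  define a where "a = \<eta> t / (2 * (4 * G\<^sup>2 * \<kappa>\<^sup>2 + 1) * R * \<eta> \<tau>)"
  have R: "1 \<le> R" using radius_ge_1[OF assms(1)] by (simp add: R_def)
  have iter_f: "iter (h(t := x)) (t - 1) = f" for x
    using assms(3) by (simp add: f_def iter_upd)
  show ?thesis
  proof (cases "\<tau> \<le> t \<and> dist_sq f \<le> R")
    case True
    have "0 \<le> a" "a * (4 * G\<^sup>2 * R * \<kappa>\<^sup>2) \<le> 1 / 2"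
      using grad_step_size[OF R assms(2), of t] True unfolding a_def by blast+
    then have "\<bar>a\<bar> * (4 * G\<^sup>2 * R * \<kappa>\<^sup>2) \<le> 1 / 2" by (simp only: abs_of_nonneg)
    then have "(\<integral>\<^sup>+x. ennreal (exp (a * (expectation (grad_noise f) - grad_noise f x)
        - a\<^sup>2 * (4 * G\<^sup>2 * R * \<kappa>\<^sup>2 * grad_sq f))) \<partial>\<rho>) \<le> 1"
    proof (rule exp_moment_le_1[rotated 2])
      show "\<bar>grad_noise f x\<bar> \<le> 4 * G\<^sup>2 * R * \<kappa>\<^sup>2" if "x \<in> space \<rho>" for x
        using abs_grad_noise_le[OF that] True R by blast
      show "a\<^sup>2 * expectation (\<lambda>x. (grad_noise f x)\<^sup>2) \<le> a\<^sup>2 * (4 * G\<^sup>2 * R * \<kappa>\<^sup>2 * grad_sq f)"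
        using True R by (intro mult_left_mono expectation_grad_noise_sq_le) auto
    qed (rule measurable_grad_noise)
    then show ?thesis
      using True unfolding grad_increment_def Let_def iter_f
      by (simp add: expectation_grad_noise R_def a_def)
  next
    case False
    then show ?thesis
      unfolding grad_increment_def Let_def iter_f by (auto simp: R_def emeasure_space_1)
  qed
qed

lemma grad_step_le:
  assumes "1 \<le> l" "1 \<le> \<tau>" "\<tau> \<le> t" and R: "dist_sq (iter h (t - 1)) \<le> radius l"
  shows "- (\<eta> t * grad_noise (iter h (t - 1)) (h t)) \<le>
    2 * (4 * G\<^sup>2 * \<kappa>\<^sup>2 + 1) * radius l * \<eta> \<tau> * grad_increment l \<tau> t h"
proof -
  define b where "b = 2 * (4 * G\<^sup>2 * \<kappa>\<^sup>2 + 1) * radius l * \<eta> \<tau>"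
  define N where "N = grad_sq (iter h (t - 1))"
  define m where "m = grad_noise (iter h (t - 1)) (h t)"
  have b: "0 < b"
    using radius_ge_1[OF assms(1)] eta_pos[OF assms(2)] by (simp add: b_def add_nonneg_pos)
  define Q where "Q = 4 * G\<^sup>2 * radius l * \<kappa>\<^sup>2"
  define a where "a = \<eta> t / b"
  have a: "0 \<le> a" "a * Q \<le> 1 / 2"
    unfolding a_def b_def Q_def by (rule grad_step_size[OF radius_ge_1[OF assms(1)] assms(2,3)])+
  have N: "0 \<le> N" by (simp add: N_def grad_sq_nonneg)
  have inc: "grad_increment l \<tau> t h = a * N - a * m - a * (a * Q * N)"
    using R assms(3) unfolding grad_increment_def Let_def
    by (simp add: a_def b_def Q_def N_def m_def power2_eq_square right_diff_distrib)
  have "a * (a * Q * N) \<le> a * (1 / 2 * N)"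
    using a N by (intro mult_left_mono mult_right_mono) auto
  moreover have "0 \<le> a * N" using a(1) N by (rule mult_nonneg_nonneg)
  ultimately have "- (a * m) \<le> grad_increment l \<tau> t h"
    unfolding inc by simp
  then have "b * (- (a * m)) \<le> b * grad_increment l \<tau> t h"
    using b by (intro mult_left_mono) auto
  moreover have "b * (- (a * m)) = - (\<eta> t * m)" using b by (simp add: a_def)
  ultimately show ?thesis unfolding b_def[symmetric] m_def[symmetric] by (simp only:)
qed

lemma excess_risk_telescope:
  assumes h: "\<And>t. 1 \<le> t \<Longrightarrow> t \<le> T \<Longrightarrow> h t \<in> space \<rho>"
    and R: "1 \<le> R" "\<And>n. n \<le> T \<Longrightarrow> dist_sq (iter h n) \<le> R" and s: "1 \<le> s" "s \<le> n" "n \<le> T"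
  shows "excess_risk (iter h n) \<le> excess_risk (iter h (s - 1))
    + (\<Sum>t = s..n. - (\<eta> t * grad_noise (iter h (t - 1)) (h t))) + descent_const * R * (\<Sum>t = s..n. \<eta> t powr (1 + \<alpha>))"
  using s(2,3)
proof (induction n rule: dec_induct)
  case base
  then show ?case
    using excess_risk_step[of h "s - 1" R] R h[of s] s(1) by simp
next
  case (step n)
  have "excess_risk (iter h (Suc n)) \<le> excess_risk (iter h n)
    - \<eta> (Suc n) * grad_noise (iter h n) (h (Suc n)) + descent_const * R * \<eta> (Suc n) powr (1 + \<alpha>)"
    using step.prems by (intro excess_risk_step h R) auto
  moreover have "s \<le> Suc n" using step.hyps by simp
  ultimately show ?case
    using step.IH step.prems by (simp add: distrib_left del: ogd.simps)
qed

lemma last_iterate_bound: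
  assumes l: "1 \<le> l" and \<tau>: "1 \<le> \<tau>" "\<tau> \<le> T"
    and h: "\<And>t. 1 \<le> t \<Longrightarrow> t \<le> T \<Longrightarrow> h t \<in> space \<rho>"
    and good1: "\<And>n. 1 \<le> n \<Longrightarrow> n \<le> T \<Longrightarrow> (\<Sum>t = 1..n. norm_increment l t h) \<le> l"
    and good2: "\<And>s. \<tau> \<le> s \<Longrightarrow> s \<le> T \<Longrightarrow> (\<Sum>t = s..T. grad_increment l \<tau> t h) \<le> l"
  shows "excess_risk (iter h T) \<le> (2 * radius l + 2 * \<kappa> * G * radius l * (l / eps * S2)) * inverse (\<Sum>t = \<tau>..T. \<eta> t)
    + 2 * (4 * G\<^sup>2 * \<kappa>\<^sup>2 + 1) * radius l * \<eta> \<tau> * l + descent_const * radius l * (\<Sum>t = \<tau>..T. \<eta> t powr (1 + \<alpha>))"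
proof -
  define R where "R = radius l"
  let ?e = "\<lambda>t. if small l t then step_coeff t * excess_risk (iter h (t - 1)) / 2 else 0"
  have R1: "1 \<le> R" using radius_ge_1[OF l] by (simp add: R_def)
  have e0: "0 \<le> ?e t" if "1 \<le> t" for t
    using step_coeff_small(2)[OF _ l that] excess_risk_nonneg by simp
  have sum_e0: "0 \<le> (\<Sum>t = 1..n. ?e t)" for n by (intro sum_nonneg) (use e0 in auto)
  have nb: "dist_sq (iter h n) + (\<Sum>t = 1..n. ?e t) \<le> R" if "n \<le> T" for n
    unfolding R_def using l h good1 that by (rule norm_bound)
  have R: "dist_sq (iter h n) \<le> R" if "n \<le> T" for n
    using nb[OF that] sum_e0[of n] by linarith
  define b where "b = 2 * (4 * G\<^sup>2 * \<kappa>\<^sup>2 + 1) * R * \<eta> \<tau>"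
  have b: "0 \<le> b"
    using R1 eta_pos[OF \<tau>(1)] by (simp add: b_def)
  define W where "W = b * l + descent_const * R * (\<Sum>t = \<tau>..T. \<eta> t powr (1 + \<alpha>))"
  \<comment> \<open>\<open>W\<close> is the same for every s: \<open>good2\<close> controls the
    increments from any starting time, and the remainder sum is enlarged to begin at \<tau>. This
    uniformity is what allows averaging over s.\<close>
  have last: "excess_risk (iter h T) \<le> excess_risk (iter h (s - 1)) + W" if s: "s \<in> {\<tau>..T}" for s
  proof -
    have "excess_risk (iter h T) \<le> excess_risk (iter h (s - 1))
      + (\<Sum>t = s..T. - (\<eta> t * grad_noise (iter h (t - 1)) (h t))) + descent_const * R * (\<Sum>t = s..T. \<eta> t powr (1 + \<alpha>))"
      using s \<tau> by (intro excess_risk_telescope[OF h R1 R]) auto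
    moreover have "(\<Sum>t = s..T. - (\<eta> t * grad_noise (iter h (t - 1)) (h t))) \<le> (\<Sum>t = s..T. b * grad_increment l \<tau> t h)"
      unfolding b_def R_def using s l \<tau> R by (intro sum_mono grad_step_le) (auto simp: R_def)
    moreover have "(\<Sum>t = s..T. b * grad_increment l \<tau> t h) \<le> b * l"
      unfolding sum_distrib_left[symmetric] using s b by (intro mult_left_mono good2) auto
    moreover have "descent_const * R * (\<Sum>t = s..T. \<eta> t powr (1 + \<alpha>)) \<le> descent_const * R * (\<Sum>t = \<tau>..T. \<eta> t powr (1 + \<alpha>))"
      using s R1 descent_const_nonneg by (intro mult_left_mono sum_mono2) auto
    ultimately show ?thesis unfolding W_def by linarith
  qed
  define H where "H = (\<Sum>t = \<tau>..T. \<eta> t)"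
  have H: "0 < H"
    unfolding H_def using \<tau> by (intro sum_pos) (auto intro: eta_pos)
  have "H * excess_risk (iter h T) = (\<Sum>s = \<tau>..T. \<eta> s * excess_risk (iter h T))"
    by (simp add: H_def sum_distrib_right)
  also have "\<dots> \<le> (\<Sum>s = \<tau>..T. \<eta> s * (excess_risk (iter h (s - 1)) + W))"
  proof (intro sum_mono mult_left_mono last)
    show "0 \<le> \<eta> s" if "s \<in> {\<tau>..T}" for s using eta_pos[of s] that \<tau> by auto
  qed
  also have "\<dots> = (\<Sum>s = \<tau>..T. \<eta> s * excess_risk (iter h (s - 1))) + H * W"
    by (simp add: distrib_left sum.distrib H_def sum_distrib_right)
  also have "(\<Sum>s = \<tau>..T. \<eta> s * excess_risk (iter h (s - 1))) \<le> (\<Sum>s = 1..T. \<eta> s * excess_risk (iter h (s - 1)))"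
    using \<tau> excess_risk_nonneg by (intro sum_mono2) (auto intro!: mult_nonneg_nonneg less_imp_le[OF eta_pos])
  \<comment> \<open>At small steps \<open>?e\<close> contains half of \<open>step_coeff\<close>,
    which is at least \<eta>, hence the factor 2. At large steps the risk is bounded crudely by 2
    \<kappa> G R and \<eta> by \<eta>^2 l / eps.\<close>
  also have "\<dots> \<le> (\<Sum>s = 1..T. 2 * ?e s + 2 * \<kappa> * G * R * (l / eps) * (\<eta> s)\<^sup>2)"
  proof (rule sum_mono)
    fix s assume "s \<in> {1..T}"
    then have s: "1 \<le> s" "s \<le> T" by auto
    have nonneg: "0 \<le> 2 * \<kappa> * G * R * (l / eps)"
      using kappa_nonneg G_nonneg R1 l eps_pos by simp
    show "\<eta> s * excess_risk (iter h (s - 1)) \<le> 2 * ?e s + 2 * \<kappa> * G * R * (l / eps) * (\<eta> s)\<^sup>2"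
    proof (cases "small l s")
      case True
      then have "\<eta> s * excess_risk (iter h (s - 1)) \<le> 2 * ?e s"
        using step_coeff_bounds(1)[OF s(1)] excess_risk_nonneg by (simp add: mult_right_mono)
      then show ?thesis using mult_nonneg_nonneg[OF nonneg zero_le_power2[of "\<eta> s"]] by linarith
    next
      case False
      have "\<eta> s * excess_risk (iter h (s - 1)) \<le> (l / eps * (\<eta> s)\<^sup>2) * (2 * \<kappa> * G * R)"
        using not_small_le[OF False l s(1)] s eta_pos[OF s(1)] l eps_pos
        by (intro mult_mono excess_risk_le R R1) (auto simp: excess_risk_nonneg)
      then show ?thesis using False by (simp add: mult_ac)
    qed
  qed
  also have "\<dots> = 2 * (\<Sum>s = 1..T. ?e s) + 2 * \<kappa> * G * R * (l / eps) * (\<Sum>s = 1..T. (\<eta> s)\<^sup>2)"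
    by (simp add: sum.distrib sum_distrib_left)
  also have "\<dots> \<le> 2 * R + 2 * \<kappa> * G * R * (l / eps) * S2"
  proof (intro add_mono mult_left_mono sum_eta_sq_le)
    show "(\<Sum>s = 1..T. ?e s) \<le> R"
      using nb[of T] dist_sq_nonneg[of "iter h T"] by linarith
  qed (use kappa_nonneg G_nonneg R1 l eps_pos in auto)
  finally have "H * excess_risk (iter h T) \<le> 2 * R + 2 * \<kappa> * G * R * (l / eps) * S2 + H * W" by simp
  then have "inverse H * (H * excess_risk (iter h T)) \<le> inverse H * (2 * R + 2 * \<kappa> * G * R * (l / eps) * S2 + H * W)"
    using H by (intro mult_left_mono) auto
  then have "excess_risk (iter h T) \<le> (2 * R + 2 * \<kappa> * G * R * (l / eps * S2)) * inverse H + W"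
    using H by (simp add: field_simps)
  then show ?thesis by (simp add: W_def b_def R_def H_def)
qed

definition rate_const :: real where
  "rate_const = 2 * radius_const * (2 + 2 * \<kappa> * G * (S2 / eps) + 2 * (4 * G\<^sup>2 * \<kappa>\<^sup>2 + 1) * \<eta> 1 powr (1 - \<alpha>) + descent_const)"

lemma last_iterate_rate:
  assumes l: "1 \<le> l" and \<tau>: "1 \<le> \<tau>" "\<tau> \<le> T"
    and h: "\<And>t. 1 \<le> t \<Longrightarrow> t \<le> T \<Longrightarrow> h t \<in> space \<rho>"
    and good1: "\<And>n. 1 \<le> n \<Longrightarrow> n \<le> T \<Longrightarrow> (\<Sum>t = 1..n. norm_increment l t h) \<le> l"
    and good2: "\<And>s. \<tau> \<le> s \<Longrightarrow> s \<le> T \<Longrightarrow> (\<Sum>t = s..T. grad_increment l \<tau> t h) \<le> l"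
  shows "excess_risk (iter h T) \<le> rate_const *
    max (max (inverse (\<Sum>t = \<tau>..T. \<eta> t)) (\<eta> \<tau> powr \<alpha>)) (\<Sum>t = \<tau>..T. \<eta> t powr (1 + \<alpha>)) * l\<^sup>2"
proof -
  define M where "M = max (max (inverse (\<Sum>t = \<tau>..T. \<eta> t)) (\<eta> \<tau> powr \<alpha>)) (\<Sum>t = \<tau>..T. \<eta> t powr (1 + \<alpha>))"
  have M: "inverse (\<Sum>t = \<tau>..T. \<eta> t) \<le> M" "\<eta> \<tau> powr \<alpha> \<le> M" "(\<Sum>t = \<tau>..T. \<eta> t powr (1 + \<alpha>)) \<le> M"
    by (auto simp: M_def)
  have M0: "0 \<le> M" using M(2) powr_ge_zero[of "\<eta> \<tau>" \<alpha>] by linarith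
  define c where "c = 2 * radius_const"
  have c: "0 \<le> c" "radius l = c * l" using radius_const_ge_1 by (auto simp: c_def radius_def)
  define g where "g = 2 * \<kappa> * G * (S2 / eps)"
  have g: "0 \<le> g" using kappa_nonneg G_nonneg S2_nonneg eps_pos by (simp add: g_def)
  have l2: "l \<le> l\<^sup>2" using l by (simp add: power2_eq_square)
  have "(2 * radius l + 2 * \<kappa> * G * radius l * (l / eps * S2)) = c * (2 * l + g * l\<^sup>2)"
    by (simp add: c g_def power2_eq_square algebra_simps)
  also have "\<dots> \<le> c * (2 * l\<^sup>2 + g * l\<^sup>2)" using c g l2 by (intro mult_left_mono add_mono) auto
  finally have "(2 * radius l + 2 * \<kappa> * G * radius l * (l / eps * S2)) * inverse (\<Sum>t = \<tau>..T. \<eta> t)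
      \<le> c * (2 * l\<^sup>2 + g * l\<^sup>2) * M"
    using M(1) M0 c g \<tau> by (intro mult_mono) (auto intro!: sum_nonneg less_imp_le[OF eta_pos] mult_nonneg_nonneg add_nonneg_nonneg)
  then have 1: "(2 * radius l + 2 * \<kappa> * G * radius l * (l / eps * S2)) * inverse (\<Sum>t = \<tau>..T. \<eta> t)
      \<le> c * (2 + g) * M * l\<^sup>2" by (simp add: algebra_simps)
  \<comment> \<open>The martingale cost is linear in \<eta> \<tau>, whereas the rate offers its
    power \<alpha>; monotone steps bound the missing power by that of \<eta> 1.\<close>
  have "\<eta> \<tau> = \<eta> \<tau> powr (1 - \<alpha>) * \<eta> \<tau> powr \<alpha>"
    using eta_pos[OF \<tau>(1)] by (simp flip: powr_add)
  also have "\<dots> \<le> \<eta> 1 powr (1 - \<alpha>) * M"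
    using eta_antimono[of 1 \<tau>] eta_pos[OF \<tau>(1)] \<tau> M alpha by (intro mult_mono powr_mono2) auto
  finally have \<eta>: "\<eta> \<tau> \<le> \<eta> 1 powr (1 - \<alpha>) * M" .
  have "2 * (4 * G\<^sup>2 * \<kappa>\<^sup>2 + 1) * radius l * \<eta> \<tau> * l = (2 * (4 * G\<^sup>2 * \<kappa>\<^sup>2 + 1) * c * l\<^sup>2) * \<eta> \<tau>"
    by (simp add: c power2_eq_square mult_ac)
  also have "\<dots> \<le> (2 * (4 * G\<^sup>2 * \<kappa>\<^sup>2 + 1) * c * l\<^sup>2) * (\<eta> 1 powr (1 - \<alpha>) * M)"
    using \<eta> c by (intro mult_left_mono) auto
  finally have 2: "2 * (4 * G\<^sup>2 * \<kappa>\<^sup>2 + 1) * radius l * \<eta> \<tau> * l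
      \<le> c * (2 * (4 * G\<^sup>2 * \<kappa>\<^sup>2 + 1) * \<eta> 1 powr (1 - \<alpha>)) * M * l\<^sup>2"
    by (simp add: mult_ac)
  have "descent_const * radius l * (\<Sum>t = \<tau>..T. \<eta> t powr (1 + \<alpha>)) \<le> descent_const * (c * l\<^sup>2) * M"
    unfolding c(2) using descent_const_nonneg c l l2 M
    by (intro mult_mono mult_left_mono) (auto intro!: sum_nonneg)
  then have 3: "descent_const * radius l * (\<Sum>t = \<tau>..T. \<eta> t powr (1 + \<alpha>)) \<le> c * descent_const * M * l\<^sup>2"
    by (simp add: mult_ac)
  have "rate_const * M * l\<^sup>2 = c * (2 + g) * M * l\<^sup>2
      + c * (2 * (4 * G\<^sup>2 * \<kappa>\<^sup>2 + 1) * \<eta> 1 powr (1 - \<alpha>)) * M * l\<^sup>2 + c * descent_const * M * l\<^sup>2"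
    unfolding rate_const_def c_def[symmetric] g_def[symmetric] by (simp only: distrib_left distrib_right)
  then show ?thesis
    using last_iterate_bound[OF l \<tau> h good1 good2] 1 2 3 unfolding M_def[symmetric] by linarith
qed

lemma rate_whp:
  fixes T :: nat and \<delta> :: real
  assumes T: "2 \<le> T" and \<delta>: "0 < \<delta>" "\<delta> < 1"
  obtains S where "S \<in> sets (samples T)" "1 - \<delta> \<le> measure (samples T) S"
    "\<And>h. h \<in> S \<Longrightarrow> excess_risk (iter h T) \<le> rate_const *
      max (max (inverse (\<Sum>t = T div 2..T. \<eta> t)) (\<eta> (T div 2) powr \<alpha>)) (\<Sum>t = T div 2..T. \<eta> t powr (1 + \<alpha>))
      * (ln (3 * real T / \<delta>))\<^sup>2"
proof -
  define l where "l = ln (3 * real T / \<delta>)"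
  define \<tau> where "\<tau> = T div 2"
  have \<tau>: "1 \<le> \<tau>" "\<tau> \<le> T" using T by (auto simp: \<tau>_def)
  \<comment> \<open>The 3 in the logarithm gives l \<ge> 1 because e \<le> 3, and it leaves room for
    two families of at most T events of probability at most \<delta> / (3 T) each.\<close>
  have "exp 1 \<le> (3 :: real)" by (rule exp_le)
  also have "\<dots> \<le> 3 * real T / \<delta>"
  proof -
    have "1 * 1 \<le> real T * (1 / \<delta>)" using T \<delta> by (intro mult_mono) auto
    then show ?thesis by simp
  qed
  finally have l: "1 \<le> l"
    using T \<delta> unfolding l_def by (subst ln_ge_iff) auto
  have exp_l: "exp (- l) = \<delta> / (3 * real T)"
    using T \<delta> by (simp add: l_def exp_minus)
  interpret P: prob_space "samples T" by (intro prob_space_PiM) unfold_locales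
  define B1 where "B1 n = {h \<in> space (samples T). l < (\<Sum>t = 1..n. norm_increment l t h)}" for n
  define B2 where "B2 s = {h \<in> space (samples T). l < (\<Sum>t = s..T. grad_increment l \<tau> t h)}" for s
  have B1: "B1 n \<in> sets (samples T)" "P.prob (B1 n) \<le> exp (- l)" if "n \<in> {1..T}" for n
  proof -
    have "(\<lambda>h. \<Sum>t = 1..n. norm_increment l t h) \<in> borel_measurable (samples T)"
      using that by (intro borel_measurable_sum norm_increment_measurable) auto
    then show "B1 n \<in> sets (samples T)" unfolding B1_def by (intro borel_measurable_less borel_measurable_const)
    show "P.prob (B1 n) \<le> exp (- l)"
      unfolding B1_def using that l
      by (intro prob_supermartingale_gt norm_increment_measurable norm_increment_upd norm_increment_moment) auto
  qed
  have B2: "B2 s \<in> sets (samples T)" "P.prob (B2 s) \<le> exp (- l)" if "s \<in> {\<tau>..T}" for s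
  proof -
    have "(\<lambda>h. \<Sum>t = s..T. grad_increment l \<tau> t h) \<in> borel_measurable (samples T)"
      using that \<tau> by (intro borel_measurable_sum grad_increment_measurable) auto
    then show "B2 s \<in> sets (samples T)" unfolding B2_def by (intro borel_measurable_less borel_measurable_const)
    show "P.prob (B2 s) \<le> exp (- l)"
      unfolding B2_def using that l \<tau>
      by (intro prob_supermartingale_gt grad_increment_measurable grad_increment_upd grad_increment_moment) auto
  qed
  \<comment> \<open>The induction on the norm needs every partial sum from 1, and the averaging
    needs every starting time s, hence the two unions.\<close>
  define bad where "bad = (\<Union>n\<in>{1..T}. B1 n) \<union> (\<Union>s\<in>{\<tau>..T}. B2 s)"
  have bad: "bad \<in> sets (samples T)" unfolding bad_def using B1 B2 by auto
  have "P.prob bad \<le> P.prob (\<Union>n\<in>{1..T}. B1 n) + P.prob (\<Union>s\<in>{\<tau>..T}. B2 s)"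
    unfolding bad_def using B1 B2 by (intro measure_Un_le) auto
  also have "\<dots> \<le> (\<Sum>n\<in>{1..T}. P.prob (B1 n)) + (\<Sum>s\<in>{\<tau>..T}. P.prob (B2 s))"
    using B1 B2 by (intro add_mono P.finite_measure_subadditive_finite) auto
  also have "\<dots> \<le> (\<Sum>n\<in>{1..T}. exp (- l)) + (\<Sum>s\<in>{\<tau>..T}. exp (- l))"
    using B1 B2 by (intro add_mono sum_mono) auto
  also have "\<dots> \<le> (\<Sum>n\<in>{1..T}. exp (- l)) + (\<Sum>n\<in>{1..T}. exp (- l))"
    using \<tau> by (intro add_left_mono sum_mono2) auto
  also have "\<dots> \<le> \<delta>"
    using T \<delta> by (simp add: exp_l field_simps)
  finally have prob_bad: "P.prob bad \<le> \<delta>" .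
  show ?thesis
  proof (rule that)
    show "space (samples T) - bad \<in> sets (samples T)" using bad by auto
    show "1 - \<delta> \<le> P.prob (space (samples T) - bad)"
      using prob_bad P.prob_compl[OF bad] by simp
    fix h assume h: "h \<in> space (samples T) - bad"
    show "excess_risk (iter h T) \<le> rate_const *
      max (max (inverse (\<Sum>t = T div 2..T. \<eta> t)) (\<eta> (T div 2) powr \<alpha>)) (\<Sum>t = T div 2..T. \<eta> t powr (1 + \<alpha>))
      * (ln (3 * real T / \<delta>))\<^sup>2"
      unfolding l_def[symmetric] \<tau>_def[symmetric]
    proof (rule last_iterate_rate[OF l \<tau>])
      show "h t \<in> space \<rho>" if "1 \<le> t" "t \<le> T" for t
        using h that by (auto simp: space_PiM PiE_def Pi_iff)
      show "(\<Sum>t = 1..n. norm_increment l t h) \<le> l" if "1 \<le> n" "n \<le> T" for n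
        using h that by (auto simp: bad_def B1_def not_less)
      show "(\<Sum>t = s..T. grad_increment l \<tau> t h) \<le> l" if "\<tau> \<le> s" "s \<le> T" for s
        using h that by (auto simp: bad_def B2_def not_less)
    qed
  qed
qed

end

section \<open>Transfer to an i.i.d. sequence on an arbitrary probability space\<close>

theorem theorem6:
  fixes X :: "(real ^ 'd) set" and Y :: "real set"
    and \<rho> :: "((real ^ 'd) \<times> real) measure"
    and K :: "real ^ 'd \<Rightarrow> real ^ 'd \<Rightarrow> real"
    and evl :: "'h::{real_inner,complete_space} \<Rightarrow> real ^ 'd \<Rightarrow> real"
    and Kx :: "real ^ 'd \<Rightarrow> 'h"
    and \<phi> \<phi>' :: "real \<Rightarrow> real \<Rightarrow> real"
    and \<alpha> L :: real
    and fH :: 'h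
    and P :: "'w measure" and z :: "nat \<Rightarrow> 'w \<Rightarrow> (real ^ 'd) \<times> real"
    and \<eta> :: "nat \<Rightarrow> real"
  assumes rho: "prob_space \<rho>" "sets \<rho> = sets (restrict_space borel (X \<times> Y))"
    and kernel: "mercer_kernel K X" and rkhs: "is_RKHS K X evl Kx"
    and kappa_fin: "bdd_above ((\<lambda>x. sqrt (K x x)) ` X)"
    and phi_nonneg: "\<And>y s. y \<in> Y \<Longrightarrow> 0 \<le> \<phi> y s"
    and phi_deriv: "\<And>y s. y \<in> Y \<Longrightarrow> (\<phi> y has_real_derivative \<phi>' y s) (at s)"
    and phi_convex: "\<And>y. y \<in> Y \<Longrightarrow> convex_on UNIV (\<phi> y)"
    and alpha: "0 < \<alpha>" "\<alpha> \<le> 1" and L: "0 < L"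
    and hoelder: "\<And>y s s'. y \<in> Y \<Longrightarrow> \<bar>\<phi>' y s - \<phi>' y s'\<bar> \<le> L * \<bar>s - s'\<bar> powr \<alpha>"
    and phi_meas: "(\<lambda>(y, s). \<phi> y s) \<in> borel_measurable (restrict_space borel (Y \<times> UNIV))"
    and phi'_meas: "(\<lambda>(y, s). \<phi>' y s) \<in> borel_measurable (restrict_space borel (Y \<times> UNIV))"
    and fH_min: "\<And>f. gen_err \<rho> \<phi> (evl fH) \<le> gen_err \<rho> \<phi> (evl f)"
    and bounded: "\<exists>B. (\<forall>y\<in>Y. \<phi> y 0 \<le> B) \<and> (\<forall>x\<in>X. \<forall>y\<in>Y. \<phi> y (evl fH x) \<le> B)"
    and P: "prob_space P"
    and iid: "prob_space.indep_vars P (\<lambda>_. \<rho>) z {1..}"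
    and distr: "\<And>t. t \<ge> 1 \<Longrightarrow> distr P \<rho> (z t) = \<rho>"
    and eta_pos: "\<And>t. t \<ge> 1 \<Longrightarrow> 0 < \<eta> t"
    and eta_le: "\<And>t. t \<ge> 1 \<Longrightarrow> \<eta> t * (constA \<alpha> L * (kappa K X)\<^sup>2) \<le> 1"
    and eta_mono: "\<And>t. t \<ge> 1 \<Longrightarrow> \<eta> (Suc t) \<le> \<eta> t"
    and eta_sq: "summable (\<lambda>t. (\<eta> (Suc t))\<^sup>2)"
  shows "\<exists>C::real. \<forall>T::nat. \<forall>\<delta>::real. T \<ge> 2 \<longrightarrow> 0 < \<delta> \<longrightarrow> \<delta> < 1 \<longrightarrow>
    (\<exists>S \<in> sets P. measure P S \<ge> 1 - \<delta> \<and>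
      (\<forall>\<omega>\<in>S. gen_err \<rho> \<phi> (evl (ogd \<phi>' evl Kx \<eta> (\<lambda>t. z t \<omega>) T))
        \<le> gen_err \<rho> \<phi> (evl fH) + ennreal (C *
            max (max (inverse (\<Sum>t = T div 2..T. \<eta> t)) (\<eta> (T div 2) powr \<alpha>))
                (\<Sum>t = T div 2..T. \<eta> t powr (1 + \<alpha>))
            * (ln (3 * real T / \<delta>))\<^sup>2)))"
proof -
  obtain B where B: "\<And>y. y \<in> Y \<Longrightarrow> \<phi> y 0 \<le> B" "\<And>x y. x \<in> X \<Longrightarrow> y \<in> Y \<Longrightarrow> \<phi> y (evl fH x) \<le> B"
    using bounded by blast
  interpret P: prob_space P by fact
  interpret \<rho>: prob_space \<rho> by fact
  \<comment> \<open>The space of a probability measure is nonempty; a point of X is needed to see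
    that the supremum \<open>kappa K X\<close> is nonnegative.\<close>
  obtain x0 where x0: "x0 \<in> X"
    using \<rho>.not_empty sets_eq_imp_space_eq[OF rho(2)] by (auto simp: space_restrict_space)
  have sqrt_le: "sqrt (K x x) \<le> kappa K X" if "x \<in> X" for x
    unfolding kappa_def using that kappa_fin by (intro cSUP_upper)
  have diag_nonneg: "0 \<le> K x x" if "x \<in> X" for x
    using rkhs that unfolding is_RKHS_def by (metis inner_ge_zero)
  have K_diag: "K x x \<le> (kappa K X)\<^sup>2" if "x \<in> X" for x
    using sqrt_le_D[OF sqrt_le[OF that]] .
  interpret kernel_online_learning \<rho> X Y K evl Kx \<phi> \<phi>' \<alpha> L "kappa K X" B fH \<eta>
  proof unfold_locales
    show "continuous_on (X \<times> X) (\<lambda>(x, y). K x y)"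
      using kernel by (simp add: mercer_kernel_def)
    show "0 \<le> kappa K X"
      using sqrt_le[OF x0] diag_nonneg[OF x0] real_sqrt_ge_zero order_trans by blast
  qed (fact assms B K_diag)+
  show ?thesis
  proof (intro exI[of _ rate_const] allI impI)
    fix T :: nat and \<delta> :: real
    assume T: "2 \<le> T" and \<delta>: "0 < \<delta>" "\<delta> < 1"
    let ?bound = "rate_const * max (max (inverse (\<Sum>t = T div 2..T. \<eta> t)) (\<eta> (T div 2) powr \<alpha>))
      (\<Sum>t = T div 2..T. \<eta> t powr (1 + \<alpha>)) * (ln (3 * real T / \<delta>))\<^sup>2"
    obtain S where S: "S \<in> sets (samples T)" "1 - \<delta> \<le> measure (samples T) S"
      "\<And>h. h \<in> S \<Longrightarrow> excess_risk (iter h T) \<le> ?bound"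
      using rate_whp[OF T \<delta>] by blast
    \<comment> \<open>The probability bound lives on the product over {1..T}. The iterate after T
      steps reads only these coordinates, so restricting the sequence does not change it.\<close>
    define Z where "Z \<omega> = (\<lambda>i\<in>{1..T}. z i \<omega>)" for \<omega>
    have z: "z i \<in> P \<rightarrow>\<^sub>M \<rho>" if "1 \<le> i" for i
      using iid that unfolding P.indep_vars_def by auto
    have Z: "Z \<in> P \<rightarrow>\<^sub>M samples T"
      unfolding Z_def[abs_def] by (intro measurable_restrict z) auto
    have "P.indep_vars (\<lambda>_. \<rho>) z {1..T}"
      using iid by (rule P.indep_vars_subset) auto
    \<comment> \<open>Independence makes the joint law a product and equality of laws makes each
      factor \<rho>, so the good event can be pulled back along \<open>Z\<close> with its
      probability.\<close>
    then have "distr P (samples T) Z = Pi\<^sub>M {1..T} (\<lambda>i. distr P \<rho> (z i))"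
      unfolding Z_def[abs_def] using T z by (subst (asm) P.indep_vars_iff_distr_eq_PiM') auto
    also have "\<dots> = samples T"
      by (intro PiM_cong) (simp_all add: distr)
    finally have distr_Z: "distr P (samples T) Z = samples T" .
    show "\<exists>S\<in>sets P. 1 - \<delta> \<le> measure P S \<and> (\<forall>\<omega>\<in>S. gen_err \<rho> \<phi> (evl (iter (\<lambda>t. z t \<omega>) T))
        \<le> gen_err \<rho> \<phi> (evl fH) + ennreal ?bound)"
    proof (intro bexI[of _ "Z -` S \<inter> space P"] conjI ballI)
      show "Z -` S \<inter> space P \<in> sets P" using Z S(1) by (rule measurable_sets)
      show "1 - \<delta> \<le> measure P (Z -` S \<inter> space P)"
        using S(2) unfolding measure_distr[OF Z S(1), symmetric] distr_Z .
      fix \<omega> assume "\<omega> \<in> Z -` S \<inter> space P"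
      then have "excess_risk (iter (Z \<omega>) T) \<le> ?bound" using S(3) by auto
      also have "iter (Z \<omega>) T = iter (\<lambda>t. z t \<omega>) T"
        by (rule iter_cong) (simp add: Z_def)
      finally show "gen_err \<rho> \<phi> (evl (iter (\<lambda>t. z t \<omega>) T)) \<le> gen_err \<rho> \<phi> (evl fH) + ennreal ?bound"
        by (subst gen_err_eq) (intro add_left_mono ennreal_leI)
    qed
  qed
qed

end
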